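(* Every equidistributed infinite permutation $\alpha$ satisfies $p_{\alpha}(n)\geq n$ for all $n\geq 1$, and this bound is attained: there exist equidistributed permutations with $p_{\alpha}(n)=n$ for all $n\geq 1$. Moreover, an equidistributed permutation $\alpha$ satisfies $p_{\alpha}(n)=n$ for all $n\geq 1$ if and only if $\alpha$ is a Sturmian permutation.
   Context: Two sequences $(a[n])_{n\ge0}$, $(b[n])_{n\ge0}$ of pairwise distinct reals are equivalent if for all $i,j$: $a[i]<a[j]\iff b[i]<b[j]$. An infinite permutation is an equivalence class of such sequences (i.e. a linear order on $\{0,1,2,\dots\}$); any sequence in the class is a representative. A factor of length $n$ of $\alpha=(\alpha[k])_{k\ge0}$ is $\alpha[i..i+n-1]=\alpha[i]\cdots\alpha[i+n-1]$, regarded only as a finite permutation (the relative order of its elements), independently of its position $i$. The complexity $p_\alpha(n)$ is the number of distinct factors of length $n$ of $\alpha$. A sequence $(a[n])$ of reals in $[0,1]$ is equidistributed if for every $t\in[0,1]$, $\lim_{n\to\infty}\frac{\#\{0\le i<n: a[i]<t\}}{n}=t$. A permutation is equidistributed if it has a representative which is an equidistributed sequence in $[0,1]$. For irrational $\sigma\in(0,1)$ and real $\rho$, the Sturmian permutation $\beta_{\sigma,\rho}$ is the permutation with representative $b[n]=\{\rho+n\sigma\}$ (fractional part); also counted as Sturmian are the permutations $\beta'_{\sigma,\rho}$ defined in the same way using the upper fractional part $x-\lceil x\rceil+1\in(0,1]$ instead of $\{x\}$. *)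

theory Defs
  imports Complex_Main
begin

text \<open>An infinite permutation is a linear order on the naturals; we represent it by its
  strict order relation. The permutation with representative a is perm_of a.\<close>
type_synonym inf_perm = "nat \<Rightarrow> nat \<Rightarrow> bool"

definition perm_of :: "(nat \<Rightarrow> real) \<Rightarrow> inf_perm" where
  "perm_of a = (\<lambda>i j. a i < a j)"

definition is_representative :: "(nat \<Rightarrow> real) \<Rightarrow> inf_perm \<Rightarrow> bool" where
  "is_representative a \<alpha> \<longleftrightarrow> inj a \<and> perm_of a = \<alpha>"

definition equidistributed_seq :: "(nat \<Rightarrow> real) \<Rightarrow> bool" where
  "equidistributed_seq a \<longleftrightarrow> (\<forall>n. a n \<in> {0..1}) \<and>
     (\<forall>t\<in>{0..1}. (\<lambda>n. real (card {i. i < n \<and> a i < t}) / real n) \<longlonglongrightarrow> t)"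

definition equidistributed_perm :: "inf_perm \<Rightarrow> bool" where
  "equidistributed_perm \<alpha> \<longleftrightarrow> (\<exists>a. is_representative a \<alpha> \<and> equidistributed_seq a)"

definition factor :: "inf_perm \<Rightarrow> nat \<Rightarrow> nat \<Rightarrow> (nat \<Rightarrow> nat \<Rightarrow> bool)" where
  "factor \<alpha> i n = (\<lambda>k l. k < n \<and> l < n \<and> \<alpha> (i + k) (i + l))"

definition complexity :: "inf_perm \<Rightarrow> nat \<Rightarrow> nat" where
  "complexity \<alpha> n = card (range (\<lambda>i. factor \<alpha> i n))"

definition upper_frac :: "real \<Rightarrow> real" where
  "upper_frac x = x - of_int \<lceil>x\<rceil> + 1"

definition sturmian_perm :: "inf_perm \<Rightarrow> bool" where
  "sturmian_perm \<alpha> \<longleftrightarrow> (\<exists>\<sigma> \<rho>. \<sigma> \<notin> \<rat> \<and> 0 < \<sigma> \<and> \<sigma> < 1 \<and>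
      (is_representative (\<lambda>n. frac (\<rho> + real n * \<sigma>)) \<alpha> \<or>
       is_representative (\<lambda>n. upper_frac (\<rho> + real n * \<sigma>)) \<alpha>))"

end

theory Submission
  imports Defs "HOL-Analysis.Kronecker_Approximation_Theorem"
begin

text \<open>
  An equidistributed sequence has no chain of positions with bounded gaps along which it is monotone,
  since such a chain would concentrate positive density near one point. Consequently the
  offset of the minimum in a sliding window of length \<open>n\<close> takes all \<open>n\<close> values: it decreases by 1
  at each step unless the new element becomes the minimum or the old minimum leaves the window.
  This gives the lower bound, and if the complexity is \<open>n\<close> then a factor is determined by the
  offset of its minimum, and likewise by that of its maximum. Rotations have this property, which bounds
  the complexity of Sturmian permutations.

  Conversely, this property forces the cyclic order of the positions to be invariant under the shift.
  Passing from windows of length \<open>n\<close> to \<open>n + 1\<close>, only the cyclic order of \<open>i\<close>, \<open>i + q\<close>, \<open>i + n\<close>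
  is new, and it can vary with \<open>i\<close> only if \<open>i\<close> and \<open>i + n\<close> are cyclic neighbours; the countdown dynamics of
  the window minimum then turns any variation into a monotone chain. Finally, the length of a
  cyclic arc is the frequency of the positions in it, so shift invariance makes \<open>a (i + 1) - a i\<close> constant
  modulo 1.
\<close>

subsection \<open>Monotone chains with bounded gaps\<close>

text \<open>From any member of such a set an infinite ascending chain with gaps at most
  \<open>m\<close> can be followed. Falling chains are the rising sets of the negated
  sequence.\<close>

definition rising :: "(nat \<Rightarrow> real) \<Rightarrow> nat \<Rightarrow> nat set \<Rightarrow> bool" where
  "rising a m S \<longleftrightarrow> (\<forall>p\<in>S. \<exists>r\<in>{1..m}. p + r \<in> S \<and> a p < a (p + r))"

lemma equidistributed_bounds:
  assumes "equidistributed_seq a"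
  shows "0 \<le> a i" "a i \<le> 1"
  using assms unfolding equidistributed_seq_def by (meson atLeastAtMost_iff)+

lemma equidistributed_interval:
  assumes "equidistributed_seq a" "0 \<le> u" "u \<le> v" "v \<le> 1"
  shows "(\<lambda>n. real (card {i. i < n \<and> u \<le> a i \<and> a i < v}) / real n) \<longlonglongrightarrow> v - u"
proof -
  have lim: "(\<lambda>n. real (card {i. i < n \<and> a i < t}) / real n) \<longlonglongrightarrow> t" if "0 \<le> t" "t \<le> 1" for t
    using assms(1) that by (auto simp: equidistributed_seq_def)
  have "real (card {i. i < n \<and> u \<le> a i \<and> a i < v})
      = real (card {i. i < n \<and> a i < v}) - real (card {i. i < n \<and> a i < u})" for n
  proof -
    have "{i. i < n \<and> u \<le> a i \<and> a i < v} = {i. i < n \<and> a i < v} - {i. i < n \<and> a i < u}"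
      by auto
    moreover have "{i. i < n \<and> a i < u} \<subseteq> {i. i < n \<and> a i < v}"
      using assms(3) by auto
    moreover have "card {i. i < n \<and> a i < u} \<le> card {i. i < n \<and> a i < v}"
      using assms(3) by (intro card_mono) auto
    ultimately show ?thesis
      by (simp add: card_Diff_subset of_nat_diff)
  qed
  then show ?thesis
    using tendsto_diff[OF lim[of v] lim[of u]] assms by (simp add: diff_divide_distrib)
qed

text \<open>The times \<open>g k\<close> have lower density at least \<open>1 / m\<close>, and all
  of them are counted in the frequency of \<open>[u, v)\<close>, which is \<open>v - u\<close>. That
  frequency is sampled along the times \<open>g k\<close>: at least \<open>k\<close> hits occur
  before a time of at most \<open>g 0 + m * k\<close>.\<close>

lemma syndetic_in_interval:
  assumes "equidistributed_seq a" "0 \<le> u" "u \<le> v" "v \<le> 1"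
    and g: "\<And>k. g k < g (Suc k)" "\<And>k. g (Suc k) \<le> g k + m"
    and uv: "\<And>k. u \<le> a (g k) \<and> a (g k) < v"
  shows "1 / real m \<le> v - u"
proof -
  have sm: "strict_mono g" using g(1) by (simp add: strict_mono_Suc_iff)
  let ?c = "\<lambda>n. card {i. i < n \<and> u \<le> a i \<and> a i < v}"
  have m: "m > 0" using g[of 0] by auto
  have c: "k \<le> ?c (g k)" for k
  proof -
    have "card (g ` {..<k}) \<le> ?c (g k)"
      using sm uv by (intro card_mono) (auto simp: strict_mono_less)
    then show ?thesis
      using sm by (simp add: card_image strict_mono_on_imp_inj_on strict_mono_imp_inj_on inj_on_subset)
  qed
  have gk: "g k \<le> g 0 + m * k" for k
  proof (induction k)
    case (Suc k)
    then show ?case using g(2)[of k] by simp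
  qed simp
  have ge: "real k / (real (g 0) + real m * real k) \<le> real (?c (g k)) / real (g k)" for k
  \<comment> \<open>Division by zero yields 0, and \<open>g k = 0\<close> forces
    \<open>k = 0\<close>, so both sides vanish.\<close>
  proof (cases "g k = 0")
    case True
    then have "k = 0" using c[of k] by simp
    then show ?thesis by simp
  next
    case False
    have "real (g k) \<le> real (g 0 + m * k)" using gk[of k] by (simp only: of_nat_le_iff)
    then show ?thesis
      using False c[of k] by (intro frac_le) auto
  qed
  have "(\<lambda>k. real k / (real (g 0) + real m * real k)) \<longlonglongrightarrow> 1 / real m"
  proof -
    have "(\<lambda>k. 1 / (real (g 0) / real k + real m)) \<longlonglongrightarrow> 1 / (0 + real m)"
      using m by (intro tendsto_intros lim_const_over_n) auto
    moreover have "\<forall>\<^sub>F k in sequentially. 1 / (real (g 0) / real k + real m)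
        = real k / (real (g 0) + real m * real k)"
      using eventually_gt_at_top[of 0] by eventually_elim (auto simp: field_simps)
    ultimately show ?thesis
      by (simp add: tendsto_cong)
  qed
  moreover have "(\<lambda>k. real (?c (g k)) / real (g k)) \<longlonglongrightarrow> v - u"
    using LIMSEQ_subseq_LIMSEQ[OF equidistributed_interval[OF assms(1-4)] sm] by (simp add: o_def)
  ultimately show ?thesis
    using ge by (intro LIMSEQ_le) auto
qed

lemma chain_of_steps:
  assumes "p \<in> S" "\<forall>p\<in>S. \<exists>r\<in>{1..m::nat}. p + r \<in> S \<and> R p (p + r)"
  shows "\<exists>g. \<forall>k. g k < g (Suc k) \<and> g (Suc k) \<le> g k + m \<and> R (g k) (g (Suc k))"
proof -
  have "\<exists>g. \<forall>k. g k \<in> S \<and> (g k < g (Suc k) \<and> g (Suc k) \<le> g k + m \<and> R (g k) (g (Suc k)))"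
  proof (rule dependent_nat_choice[where P = "\<lambda>_ x. x \<in> S"
        and Q = "\<lambda>_ x y. x < y \<and> y \<le> x + m \<and> R x y"])
    fix x and k :: nat assume "x \<in> S"
    then obtain r where "r \<in> {1..m}" "x + r \<in> S" "R x (x + r)" using assms(2) by blast
    then show "\<exists>y. y \<in> S \<and> x < y \<and> y \<le> x + m \<and> R x y"
      by (intro exI[of _ "x + r"]) auto
  qed (use assms(1) in auto)
  then show ?thesis by blast
qed

text \<open>A rising chain converges to its limit \<open>L\<close> from below, so its tail lies in
  an interval of length at most \<open>1 / (2 * m)\<close> ending at \<open>L\<close>, too short for
  gaps of at most \<open>m\<close>.\<close>

lemma equidistributed_not_rising:
  assumes eq: "equidistributed_seq a" and "rising a m S"
  shows "S = {}"
proof (rule ccontr)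
  assume "S \<noteq> {}"
  then obtain p where "p \<in> S" by auto
  then obtain g where "\<forall>k. g k < g (Suc k) \<and> g (Suc k) \<le> g k + m \<and> a (g k) < a (g (Suc k))"
    using chain_of_steps[of p S m "\<lambda>p q. a p < a q"] assms(2) by (auto simp: rising_def)
  then have g: "\<And>k. g k < g (Suc k)" "\<And>k. g (Suc k) \<le> g k + m" "\<And>k. a (g k) < a (g (Suc k))"
    by blast+
  note ab = equidistributed_bounds[OF eq]
  have inc: "incseq (\<lambda>k. a (g k))" using g(3) by (intro incseq_SucI) (auto intro: less_imp_le)
  then obtain L where L: "(\<lambda>k. a (g k)) \<longlonglongrightarrow> L" "\<And>k. a (g k) \<le> L"
    using incseq_convergent[OF inc, of 1] ab by blast
  have L1: "0 \<le> L" "L \<le> 1" using L(2)[of 0] ab[of "g 0"] LIMSEQ_le_const2[OF L(1), of 1] ab by (linarith, blast)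
  have lt: "a (g k) < L" for k using g(3)[of k] L(2)[of "Suc k"] by simp
  have m: "m > 0" using g(1,2)[of 0] by auto
  define e where "e = 1 / (2 * real m)"
  have e: "0 < e" "e < 1 / real m" using m by (auto simp: e_def field_simps)
  obtain K where K: "\<And>k. k \<ge> K \<Longrightarrow> L - e < a (g k)"
    using order_tendstoD(1)[OF L(1), of "L - e"] e by (auto simp: eventually_sequentially)
  have "1 / real m \<le> L - max 0 (L - e)"
    by (rule syndetic_in_interval[OF eq, where g = "\<lambda>k. g (k + K)"])
      (use g lt K ab L1 e in \<open>auto simp: less_imp_le\<close>)
  then show False using e by auto
qed

lemma equidistributed_not_falling:
  assumes eq: "equidistributed_seq a" and "rising (\<lambda>i. - a i) m S"
  shows "S = {}"
proof (rule ccontr)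
  assume "S \<noteq> {}"
  then obtain p where "p \<in> S" by auto
  then obtain g where "\<forall>k. g k < g (Suc k) \<and> g (Suc k) \<le> g k + m \<and> a (g (Suc k)) < a (g k)"
    using chain_of_steps[of p S m "\<lambda>p q. a q < a p"] assms(2) by (auto simp: rising_def)
  then have g: "\<And>k. g k < g (Suc k)" "\<And>k. g (Suc k) \<le> g k + m" "\<And>k. a (g (Suc k)) < a (g k)"
    by blast+
  note ab = equidistributed_bounds[OF eq]
  have dec: "decseq (\<lambda>k. a (g k))" using g(3) by (intro decseq_SucI) (auto intro: less_imp_le)
  then obtain L where L: "(\<lambda>k. a (g k)) \<longlonglongrightarrow> L" "\<And>k. L \<le> a (g k)"
    using decseq_convergent[OF dec, of 0] ab by blast
  have L1: "0 \<le> L" "L \<le> 1" using L(2)[of 0] ab[of "g 0"] LIMSEQ_le_const[OF L(1), of 0] ab by (blast, linarith)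
  \<comment> \<open>The half-open interval has to end at \<open>min 1 (L + e)\<close>, and only the
    first term of a falling chain can equal 1; hence the chain is used from its second term
    on.\<close>
  have lt: "a (g (Suc k)) < 1" for k using g(3)[of k] ab[of "g k"] by linarith
  have m: "m > 0" using g(1,2)[of 0] by auto
  define e where "e = 1 / (2 * real m)"
  have e: "0 < e" "e < 1 / real m" using m by (auto simp: e_def field_simps)
  obtain K where K: "\<And>k. k \<ge> K \<Longrightarrow> a (g k) < L + e"
    using order_tendstoD(2)[OF L(1), of "L + e"] e by (auto simp: eventually_sequentially)
  have "1 / real m \<le> min 1 (L + e) - L"
    by (rule syndetic_in_interval[OF eq, where g = "\<lambda>k. g (Suc (k + K))"])
      (use g lt K L L1 e in \<open>auto simp: less_imp_le\<close>)
  then show False using e by auto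
qed

subsection \<open>Window minima and complexity\<close>

text \<open>The offset \<open>j\<close> is counted from the start \<open>i\<close> of the window.
  Applied to the negated sequence, this describes the window maximum.\<close>

definition window_min :: "(nat \<Rightarrow> real) \<Rightarrow> nat \<Rightarrow> nat \<Rightarrow> nat \<Rightarrow> bool" where
  "window_min a n i j \<longleftrightarrow> j < n \<and> (\<forall>k<n. k \<noteq> j \<longrightarrow> a (i + j) < a (i + k))"

lemma window_min_less: "window_min a n i j \<Longrightarrow> j < n"
  by (simp add: window_min_def)

lemma window_minD: "window_min a n i j \<Longrightarrow> k < n \<Longrightarrow> k \<noteq> j \<Longrightarrow> a (i + j) < a (i + k)"
  by (simp add: window_min_def)

lemma window_min_unique: "window_min a n i j \<Longrightarrow> window_min a n i j' \<Longrightarrow> j = j'"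
  using window_minD window_min_less by (metis less_asym)

lemma window_min_exists:
  assumes "inj a" "0 < n"
  shows "\<exists>j. window_min a n i j"
proof -
  obtain j where j: "j \<in> {..<n}" "\<And>k. k \<in> {..<n} \<Longrightarrow> a (i + j) \<le> a (i + k)"
    using ex_min_if_finite[of "(\<lambda>k. a (i + k)) ` {..<n}"] assms(2) by (fastforce simp: not_less)
  moreover have "a (i + j) \<noteq> a (i + k)" if "k \<noteq> j" for k
    using injD[OF assms(1), of "i + j" "i + k"] that by auto
  ultimately show ?thesis
    unfolding window_min_def by (metis lessThan_iff order_le_less)
qed

lemma window_min_Suc_window:
  assumes "window_min a n i j" "a (i + j) < a (i + n)"
  shows "window_min a (Suc n) i j"
  using assms by (auto simp: window_min_def less_Suc_eq)

lemma window_min_new: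
  assumes "window_min a n i j" "a (i + n) < a (i + j)"
  shows "window_min a (Suc n) i n"
  using assms less_trans unfolding window_min_def by (metis less_Suc_eq)

lemma window_min_subwindow:
  assumes "window_min a (Suc n) i j" "j < n"
  shows "window_min a n i j"
  using assms by (auto simp: window_min_def)

lemma window_min_shift:
  assumes "window_min a (Suc n) i (Suc j)"
  shows "window_min a n (Suc i) j"
  using assms by (force simp: window_min_def)

text \<open>A minimum that is not the first element survives the slide of the window, and only the
  incoming element can displace it.\<close>

lemma window_min_step:
  assumes "inj a" "window_min a n i (Suc j)"
  shows "window_min a n (Suc i) j \<or> window_min a n (Suc i) (n - 1)"
proof -
  have n: "Suc j < n" using assms by (auto simp: window_min_def)
  have "a (i + Suc j) \<noteq> a (i + n)" using injD[OF assms(1), of "i + Suc j" "i + n"] n by auto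
  then show ?thesis
    using window_min_shift[OF window_min_Suc_window[OF assms(2)]]
      window_min_shift[of a n i "n - 1"] window_min_new[OF assms(2)] n by fastforce
qed

text \<open>Apart from injectivity, this is all that the combinatorial part takes from
  equidistribution. It is symmetric under negation, so results on minima transfer to maxima.\<close>

locale chain_free =
  fixes a :: "nat \<Rightarrow> real"
  assumes inj: "inj a"
    and not_rising: "rising a m S \<Longrightarrow> S = {}"
    and not_falling: "rising (\<lambda>i. - a i) m S \<Longrightarrow> S = {}"
begin

lemma neq: "i \<noteq> j \<Longrightarrow> a i \<noteq> a j"
  using inj by (auto dest: injD)

text \<open>Otherwise every late position has a smaller value fewer than \<open>n\<close> steps
  ahead, and the late positions form a falling set.\<close>

lemma window_min_first:
  assumes "0 < n"
  shows "\<exists>i\<ge>N. window_min a n i 0"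
proof (rule ccontr)
  assume "\<not> ?thesis"
  then have none: "\<not> window_min a n i 0" if "i \<ge> N" for i using that by blast
  have "rising (\<lambda>i. - a i) n {N..}"
    unfolding rising_def
  proof
    fix p assume "p \<in> {N..}"
    then obtain k where k: "k < n" "k \<noteq> 0" "\<not> a p < a (p + k)"
      using none[of p] assms by (auto simp: window_min_def)
    then have "a (p + k) < a p" using neq[of p "p + k"] by auto
    then show "\<exists>r\<in>{1..n}. p + r \<in> {N..} \<and> - a p < - a (p + r)"
      using k \<open>p \<in> {N..}\<close> by (intro bexI[of _ k]) auto
  qed
  from not_falling[OF this] show False by auto
qed

text \<open>If the incoming element is never the minimum, every offset counts down to 0. From a
  position that is the minimum of its own window, the minimum of the next window is then a larger
  value ahead, which in turn becomes the first element and minimum of its window: a rising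
  set.\<close>

lemma window_min_last:
  assumes "0 < n"
  shows "\<exists>i\<ge>N. window_min a n i (n - 1)"
proof (rule ccontr)
  assume "\<not> ?thesis"
  then have none: "\<not> window_min a n i (n - 1)" if "i \<ge> N" for i using that by blast
  have countdown: "window_min a n i j \<Longrightarrow> i \<ge> N \<Longrightarrow> window_min a n (i + j) 0" for i j
  proof (induction j arbitrary: i)
    case (Suc j)
    then have "window_min a n (Suc i) j"
      using window_min_step[OF inj Suc.prems(1)] none[of "Suc i"] by auto
    then show ?case using Suc.IH[of "Suc i"] Suc.prems(2) by simp
  qed simp
  let ?S = "{p. p \<ge> N \<and> window_min a n p 0}"
  have "rising a n ?S"
    unfolding rising_def
  proof
    fix p assume p: "p \<in> ?S"
    obtain j where j: "window_min a n (Suc p) j" using window_min_exists[OF inj assms] by blast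
    then have "j \<noteq> n - 1" "j < n" using none[of "Suc p"] p by (auto simp: window_min_def)
    then have "Suc j < n" by linarith
    then have "a p < a (p + Suc j)" using p window_minD[of a n p 0 "Suc j"] by simp
    moreover have "window_min a n (p + Suc j) 0" using countdown[OF j] p by simp
    ultimately show "\<exists>r\<in>{1..n}. p + r \<in> ?S \<and> a p < a (p + r)"
      using p \<open>Suc j < n\<close> by (intro bexI[of _ "Suc j"]) auto
  qed
  moreover have "?S \<noteq> {}" using window_min_first[OF assms, of N] by blast
  ultimately show False using not_rising by blast
qed

text \<open>The offset moves down by single steps or jumps to \<open>n - 1\<close>. On its way from
  \<open>n - 1\<close> to 0 it therefore cannot skip \<open>j\<close>.\<close>

lemma window_min_recurrent:
  assumes "j < n"
  shows "\<exists>i\<ge>N. window_min a n i j"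
proof (rule ccontr)
  assume "\<not> ?thesis"
  then have none: "\<not> window_min a n i j" if "i \<ge> N" for i using that by blast
  have n: "0 < n" using assms by simp
  obtain i where i: "i \<ge> N" "window_min a n i (n - 1)" using window_min_last[OF n] by blast
  have jn: "j < n - 1" using assms none[OF i(1)] i(2) by (cases "j = n - 1") auto
  have stay: "\<exists>k. j < k \<and> window_min a n (i + t) k" for t
  proof (induction t)
    case (Suc t)
    then obtain k where k: "Suc k > j" "window_min a n (i + t) (Suc k)"
      by (metis not_less_zero not0_implies_Suc)
    then have "window_min a n (i + Suc t) k \<or> window_min a n (i + Suc t) (n - 1)"
      using window_min_step[OF inj] by simp
    moreover have "k > j" if "window_min a n (i + Suc t) k"
      using that k none[of "i + Suc t"] i by (cases "k = j") auto
    ultimately show ?case using jn by blast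
  qed (use i jn in auto)
  obtain i' where i': "i' \<ge> i" "window_min a n i' 0" using window_min_first[OF n] by blast
  then have "i' = i + (i' - i)" by simp
  then show False using stay[of "i' - i"] i'(2) window_min_unique by (metis not_less_zero)
qed

end

lemma chain_free_equidistributed:
  assumes "inj a" "equidistributed_seq a"
  shows "chain_free a"
  using assms equidistributed_not_rising equidistributed_not_falling by unfold_locales

lemma chain_free_uminus:
  assumes "chain_free a"
  shows "chain_free (\<lambda>i. - a i)"
proof -
  interpret chain_free a by fact
  show ?thesis
    using inj not_rising not_falling by unfold_locales (auto simp: inj_def)
qed

section \<open>Factors and the offsets of their minima\<close>

definition same_pattern :: "(nat \<Rightarrow> real) \<Rightarrow> nat \<Rightarrow> nat \<Rightarrow> nat \<Rightarrow> bool" where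
  "same_pattern a n i i' \<longleftrightarrow> (\<forall>k<n. \<forall>l<n. a (i + k) < a (i + l) \<longleftrightarrow> a (i' + k) < a (i' + l))"

lemma factor_eq_iff: "factor (perm_of a) i n = factor (perm_of a) i' n \<longleftrightarrow> same_pattern a n i i'"
  unfolding factor_def perm_of_def same_pattern_def fun_eq_iff by blast

lemma same_pattern_window_min:
  assumes "same_pattern a n i i'" "window_min a n i j"
  shows "window_min a n i' j"
  using assms by (auto simp: same_pattern_def window_min_def)

lemma finite_factors: "finite (range (\<lambda>i. factor \<alpha> i n))"
proof -
  have "range (\<lambda>i. factor \<alpha> i n) \<subseteq> (\<lambda>R k l. (k, l) \<in> R) ` Pow ({..<n} \<times> {..<n})"
  proof clarify
    fix i
    have "factor \<alpha> i n = (\<lambda>k l. (k, l) \<in> {(k, l). factor \<alpha> i n k l})" by simp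
    moreover have "{(k, l). factor \<alpha> i n k l} \<subseteq> {..<n} \<times> {..<n}" by (auto simp: factor_def)
    ultimately show "factor \<alpha> i n \<in> (\<lambda>R k l. (k, l) \<in> R) ` Pow ({..<n} \<times> {..<n})" by blast
  qed
  then show ?thesis by (rule finite_subset) simp
qed

lemma factor_determines_window_min:
  assumes "inj a" "0 < n"
  shows "\<exists>\<phi>. \<forall>i. window_min a n i (\<phi> (factor (perm_of a) i n))"
proof
  \<comment> \<open>The offset is read off in some window showing the factor; windows with equal
    factors have their minima at equal offsets, so any of them will do.\<close>
  let ?\<phi> = "\<lambda>f. SOME j. \<exists>i. f = factor (perm_of a) i n \<and> window_min a n i j"
  show "\<forall>i. window_min a n i (?\<phi> (factor (perm_of a) i n))"
  proof
    fix i
    have "\<exists>i'. factor (perm_of a) i n = factor (perm_of a) i' n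
        \<and> window_min a n i' (?\<phi> (factor (perm_of a) i n))"
      by (rule someI_ex) (use window_min_exists[OF assms] in blast)
    then show "window_min a n i (?\<phi> (factor (perm_of a) i n))"
      using same_pattern_window_min factor_eq_iff by metis
  qed
qed

context chain_free
begin

text \<open>Every offset recurs, so the map from factors to offsets is onto. Both the lower bound
  and the analysis of equality rest on this.\<close>

lemma window_min_factors_image:
  assumes "0 < n"
    and \<phi>: "\<forall>i. window_min a n i (\<phi> (factor (perm_of a) i n))"
  shows "\<phi> ` range (\<lambda>i. factor (perm_of a) i n) = {..<n}"
proof (intro equalityI subsetI)
  fix j assume "j \<in> {..<n}"
  then obtain i where "window_min a n i j" using window_min_recurrent by blast
  then have "j = \<phi> (factor (perm_of a) i n)" using \<phi> window_min_unique by blast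
  then show "j \<in> \<phi> ` range (\<lambda>i. factor (perm_of a) i n)" by blast
qed (use \<phi> window_min_less in blast)

lemma complexity_ge:
  assumes "0 < n"
  shows "n \<le> complexity (perm_of a) n"
proof -
  obtain \<phi> where \<phi>: "\<forall>i. window_min a n i (\<phi> (factor (perm_of a) i n))"
    using factor_determines_window_min[OF inj assms] ..
  show ?thesis
    unfolding complexity_def
    using card_image_le[OF finite_factors, of \<phi> "perm_of a" n] window_min_factors_image[OF assms \<phi>] by simp
qed

text \<open>With exactly \<open>n\<close> factors, the surjection onto the \<open>n\<close> offsets
  is a bijection.\<close>

lemma window_min_determines_factor:
  assumes "complexity (perm_of a) n = n" "window_min a n i j" "window_min a n i' j"
  shows "same_pattern a n i i'"
proof -
  have n: "0 < n" using assms(2) by (auto simp: window_min_def)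
  obtain \<phi> where \<phi>: "\<forall>i. window_min a n i (\<phi> (factor (perm_of a) i n))"
    using factor_determines_window_min[OF inj n] ..
  have "inj_on \<phi> (range (\<lambda>i. factor (perm_of a) i n))"
    using window_min_factors_image[OF n \<phi>] assms(1)
    by (intro eq_card_imp_inj_on finite_factors) (simp add: complexity_def)
  moreover have "\<phi> (factor (perm_of a) i n) = \<phi> (factor (perm_of a) i' n)"
    using \<phi> assms window_min_unique by metis
  ultimately show ?thesis
    unfolding factor_eq_iff[symmetric] by (meson inj_onD rangeI)
qed

end

lemma complexity_le:
  assumes "inj a" "0 < n"
    and "\<And>i i' j. window_min a n i j \<Longrightarrow> window_min a n i' j \<Longrightarrow> same_pattern a n i i'"
  shows "complexity (perm_of a) n \<le> n"
proof -
  obtain \<phi> where \<phi>: "\<forall>i. window_min a n i (\<phi> (factor (perm_of a) i n))"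
    using factor_determines_window_min[OF assms(1,2)] ..
  have sub: "\<phi> ` range (\<lambda>i. factor (perm_of a) i n) \<subseteq> {..<n}"
    using \<phi> window_min_less by blast
  have "inj_on \<phi> (range (\<lambda>i. factor (perm_of a) i n))"
  proof (rule inj_onI, clarify)
    fix i i' assume "\<phi> (factor (perm_of a) i n) = \<phi> (factor (perm_of a) i' n)"
    then have "same_pattern a n i i'" using \<phi> assms(3) by metis
    then show "factor (perm_of a) i n = factor (perm_of a) i' n" by (simp add: factor_eq_iff)
  qed
  then have "card (range (\<lambda>i. factor (perm_of a) i n)) \<le> card {..<n}"
    using sub by (metis card_inj_on_le finite_lessThan)
  then show ?thesis by (simp add: complexity_def)
qed

lemma same_pattern_uminus: "same_pattern (\<lambda>i. - a i) n i i' \<longleftrightarrow> same_pattern a n i i'"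
  unfolding same_pattern_def by auto

text \<open>Negation transposes every factor, and transposition is injective.\<close>

lemma complexity_uminus: "complexity (perm_of (\<lambda>i. - a i)) n = complexity (perm_of a) n"
proof -
  have "factor (perm_of (\<lambda>i. - a i)) i n = (\<lambda>k l. factor (perm_of a) i n l k)" for i
    by (intro ext) (auto simp: factor_def perm_of_def)
  then have "range (\<lambda>i. factor (perm_of (\<lambda>i. - a i)) i n)
      = (\<lambda>f k l. f l k) ` range (\<lambda>i. factor (perm_of a) i n)"
    by (simp add: image_image)
  moreover have "inj (\<lambda>f::nat \<Rightarrow> nat \<Rightarrow> bool. \<lambda>k l. f l k)"
    by (rule injI) (metis ext)
  ultimately show ?thesis
    unfolding complexity_def by (metis card_image inj_on_subset subset_UNIV)
qed

section \<open>Permutations of minimal complexity\<close>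

text \<open>Requiring the condition for maxima along with that for minima makes the locale closed
  under negation.\<close>

locale minimal_perm = chain_free +
  assumes window_min_pattern: "window_min a n i j \<Longrightarrow> window_min a n i' j \<Longrightarrow> same_pattern a n i i'"
    and window_max_pattern: "window_min (\<lambda>i. - a i) n i j \<Longrightarrow> window_min (\<lambda>i. - a i) n i' j \<Longrightarrow> same_pattern a n i i'"

lemma minimal_perm_uminus:
  assumes "minimal_perm a"
  shows "minimal_perm (\<lambda>i. - a i)"
proof -
  interpret minimal_perm a by fact
  interpret neg: chain_free "\<lambda>i. - a i" using chain_free_uminus chain_free_axioms .
  show ?thesis
    using window_min_pattern window_max_pattern by unfold_locales (simp_all add: same_pattern_uminus)
qed

lemma minimal_perm_complexity:
  assumes "chain_free a" "\<forall>n\<ge>1. complexity (perm_of a) n = n"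
  shows "minimal_perm a"
proof -
  interpret chain_free a by fact
  interpret neg: chain_free "\<lambda>i. - a i" using chain_free_uminus chain_free_axioms .
  show ?thesis
  proof unfold_locales
    fix n i i' j assume "window_min a n i j" "window_min a n i' j"
    then show "same_pattern a n i i'"
      using window_min_determines_factor assms(2) window_min_less by (metis One_nat_def Suc_leI gr_zeroI not_less_zero)
  next
    fix n i i' j assume *: "window_min (\<lambda>i. - a i) n i j" "window_min (\<lambda>i. - a i) n i' j"
    then have "1 \<le> n" by (auto simp: window_min_def)
    then show "same_pattern a n i i'"
      using neg.window_min_determines_factor[OF _ *] assms(2) by (simp add: complexity_uminus same_pattern_uminus)
  qed
qed

subsection \<open>Shift invariance of the cyclic order\<close>

lemma countdown:
  fixes J :: "nat \<Rightarrow> nat"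
  assumes "\<And>i j. J i = Suc j \<Longrightarrow> J (Suc i) = j" "J i = k + l"
  shows "J (i + k) = l"
  using assms(2)
proof (induction k arbitrary: i)
  case (Suc k)
  then have "J (Suc i) = k + l" using assms(1)[of i "k + l"] by simp
  then show ?case using Suc.IH[of "Suc i"] by simp
qed simp

text \<open>In the application \<open>J i\<close> is the offset of the minimum in the window at
  \<open>i\<close>, and \<open>i + y\<close> is the cyclic successor of \<open>i\<close> there.
  Jumps by \<open>n\<close> from value \<open>j\<close> and jumps by \<open>y\<close> from values
  other than \<open>y\<close> ascend, and they can be combined so as to return to value
  \<open>j\<close> forever.\<close>

lemma countdown_rising:
  fixes a :: "nat \<Rightarrow> real" and J :: "nat \<Rightarrow> nat"
  assumes down: "\<And>i j. J i = Suc j \<Longrightarrow> J (Suc i) = j"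
    and reset: "\<And>i. J i = 0 \<Longrightarrow> J (Suc i) = n - 1 \<or> J (Suc i) = y - 1"
    and y: "0 < y" "y < n" and j: "0 < j" "j < n"
    and top: "\<And>N. \<exists>i\<ge>N. J i = n - 1"
    and up_n: "\<And>i. J i = j \<Longrightarrow> a i < a (i + n)"
    and up_y: "\<And>i. J i \<noteq> y \<Longrightarrow> a i < a (i + y)"
  shows "\<exists>S. S \<noteq> {} \<and> rising a n S"
proof -
  note downs = countdown[of J, OF down]
  have visit: "\<exists>i. J i = j"
  proof -
    obtain i where "J i = n - 1" using top by blast
    then have "J (i + (n - 1 - j)) = j" using downs[of i "n - 1 - j" j] j by simp
    then show ?thesis by blast
  qed
  show ?thesis
  proof (cases "j < y")
    case True
    \<comment> \<open>Both reset values are at least \<open>j\<close>, so the next visit to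
      \<open>j\<close> comes exactly \<open>n\<close> or \<open>y\<close> steps later.\<close>
    have "rising a n {i. J i = j}"
      unfolding rising_def
    proof
      fix i assume "i \<in> {i. J i = j}"
      then have i: "J i = j" by simp
      have zero: "J (i + j) = 0" using downs[of i j 0] i by simp
      consider "J (Suc (i + j)) = n - 1" | "J (Suc (i + j)) = y - 1" using reset[OF zero] by blast
      then show "\<exists>r\<in>{1..n}. i + r \<in> {i. J i = j} \<and> a i < a (i + r)"
      proof cases
        case 1
        then have "J (i + n) = j" using downs[of "Suc (i + j)" "n - 1 - j" j] j by simp
        then show ?thesis using up_n[OF i] y by (intro bexI[of _ n]) auto
      next
        case 2
        then have "J (i + y) = j" using downs[of "Suc (i + j)" "y - 1 - j" j] True by simp
        then show ?thesis using up_y[of i] i True y by (intro bexI[of _ y]) auto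
      qed
    qed
    then show ?thesis using visit by (intro exI[of _ "{i. J i = j}"]) auto
  next
    case False
    \<comment> \<open>For \<open>j \<ge> y\<close> a reset to \<open>y - 1\<close> bypasses the
      value \<open>j\<close>, or all but bypasses it from below. \<open>S\<close> collects the
      positions from which \<open>T\<close> ascending jumps by \<open>y\<close> lead to value
      \<open>j\<close>.\<close>
    define S where "S = {p. \<exists>T. J (p + T * y) = j \<and> (\<forall>t<T. J (p + t * y) \<noteq> y)}"
    \<comment> \<open>A reset to \<open>y - 1\<close> delays the next zero by \<open>y\<close> and
      is made up for by one more jump by \<open>y\<close>. The induction is on the waiting time for
      the value \<open>n - 1\<close>.\<close>
    have ret: "u + (n - j) \<in> S" if "J u = 0" for u
    proof -
      obtain d where d: "J (u + Suc d) = n - 1" using top[of "Suc u"] by (metis add_Suc_shift le_Suc_ex)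
      then show ?thesis
        using that
      proof (induction d arbitrary: u rule: less_induct)
        case (less d)
        consider "J (Suc u) = n - 1" | "J (Suc u) = y - 1" "J (Suc u) \<noteq> n - 1"
          using reset[OF less.prems(2)] by blast
        then show ?case
        proof cases
          case 1
          then have "J (Suc u + (n - 1 - j)) = j" using downs[of "Suc u" "n - 1 - j" j] j by simp
          moreover have "Suc u + (n - 1 - j) = u + (n - j)" using j by simp
          ultimately have "J (u + (n - j)) = j" by metis
          then show ?thesis unfolding S_def by (intro CollectI exI[of _ 0]) simp
        next
          case 2
          have zero: "J (u + y) = 0" using downs[of "Suc u" "y - 1" 0] 2 y by simp
          have low: "J (Suc u + k) = y - 1 - k" if "k < y" for k
            using downs[of "Suc u" k "y - 1 - k"] 2 that by simp
          have "d \<ge> y"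
          proof (rule ccontr)
            assume "\<not> d \<ge> y"
            then have "J (u + Suc d) = y - 1 - d" using low[of d] by simp
            then show False using less.prems(1) y by simp
          qed
          then obtain d' where d': "d = y + d'" using le_Suc_ex by blast
          then have "u + y + (n - j) \<in> S"
            using less.IH[of d' "u + y"] less.prems(1) zero y by (simp add: ac_simps)
          then obtain T where T: "J (u + y + (n - j) + T * y) = j"
              "\<forall>t<T. J (u + y + (n - j) + t * y) \<noteq> y"
            unfolding S_def by blast
          have ne: "J (u + (n - j)) \<noteq> y"
          proof
            assume v: "J (u + (n - j)) = y"
            \<comment> \<open>A value \<open>\<ge> y\<close> below \<open>n - 1\<close> can only be reached by counting down from its successor.\<close>
            have climb: "k < n - y \<Longrightarrow> k < n - j \<Longrightarrow> J (u + (n - j) - k) = y + k" for k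
            proof (induction k)
              case (Suc k)
              let ?i = "u + (n - j) - Suc k"
              have Si: "Suc ?i = u + (n - j) - k" using Suc.prems by simp
              then have J: "J (Suc ?i) = y + k" using Suc by simp
              have "J ?i \<noteq> 0"
              proof
                assume "J ?i = 0"
                then have "y + k = n - 1 \<or> y + k = y - 1" using reset[of ?i] J by metis
                then show False using Suc.prems y by linarith
              qed
              then obtain l where "J ?i = Suc l" using not0_implies_Suc by blast
              then show ?case using down[of ?i l] J by simp
            qed (use v in simp)
            have "J (u + (n - j) - (n - j - 1)) = y + (n - j - 1)"
              by (rule climb) (use False j y in auto)
            moreover have "u + (n - j) - (n - j - 1) = Suc u" using j by simp
            ultimately show False using 2(1) y by simp
          qed
          have "\<forall>t<Suc T. J (u + (n - j) + t * y) \<noteq> y"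
          proof (intro allI impI)
            fix t assume "t < Suc T"
            then show "J (u + (n - j) + t * y) \<noteq> y"
              using ne T(2) by (cases t) (auto simp: ac_simps)
          qed
          moreover have "J (u + (n - j) + Suc T * y) = j" using T(1) by (simp add: ac_simps)
          ultimately show ?thesis unfolding S_def by blast
        qed
      qed
    qed
    have "rising a n S"
      unfolding rising_def
    proof
      fix p assume "p \<in> S"
      then obtain T where T: "J (p + T * y) = j" "\<forall>t<T. J (p + t * y) \<noteq> y" unfolding S_def by blast
      show "\<exists>r\<in>{1..n}. p + r \<in> S \<and> a p < a (p + r)"
      proof (cases T)
        case 0
        then have p: "J p = j" using T by simp
        then have "J (p + j) = 0" using downs[of p j 0] by simp
        then have "p + j + (n - j) \<in> S" by (rule ret)
        then show ?thesis using up_n[OF p] j by (intro bexI[of _ n]) auto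
      next
        case (Suc T')
        have "J (p + y + t * y) \<noteq> y" if "t < T'" for t
          using T(2)[rule_format, of "Suc t"] that Suc by (simp add: ac_simps)
        moreover have "J (p + y + T' * y) = j" using T(1) Suc by (simp add: ac_simps)
        ultimately have "p + y \<in> S" unfolding S_def by blast
        moreover have "J p \<noteq> y" using T(2)[rule_format, of 0] Suc by simp
        ultimately show ?thesis using up_y[of p] y by (intro bexI[of _ y]) auto
      qed
    qed
    moreover have "S \<noteq> {}"
    proof -
      obtain i where "J i = j" using visit by blast
      then have "i \<in> S" unfolding S_def by (intro CollectI exI[of _ 0]) simp
      then show ?thesis by blast
    qed
    ultimately show ?thesis by blast
  qed
qed

section \<open>The cyclic order of values\<close>

text \<open>The strict cyclic order of the line closed up to a circle: on the way up from
  \<open>x\<close>, \<open>y\<close> is met before \<open>z\<close>.\<close>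

definition cyc :: "real \<Rightarrow> real \<Rightarrow> real \<Rightarrow> bool" where
  "cyc x y z \<longleftrightarrow> x < y \<and> y < z \<or> y < z \<and> z < x \<or> z < x \<and> x < y"

lemma cyc_rotate: "cyc x y z \<longleftrightarrow> cyc y z x"
  by (auto simp: cyc_def)

lemma cyc_uminus: "x \<noteq> y \<Longrightarrow> y \<noteq> z \<Longrightarrow> x \<noteq> z \<Longrightarrow> cyc (- x) (- y) (- z) \<longleftrightarrow> \<not> cyc x y z"
  by (auto simp: cyc_def)

lemma cyc_swap: "x \<noteq> y \<Longrightarrow> y \<noteq> z \<Longrightarrow> x \<noteq> z \<Longrightarrow> cyc z y x \<longleftrightarrow> \<not> cyc x y z"
  by (auto simp: cyc_def)

definition cyc_invariant :: "(nat \<Rightarrow> real) \<Rightarrow> nat \<Rightarrow> bool" where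
  "cyc_invariant a n \<longleftrightarrow> (\<forall>i i' p q r. p < n \<longrightarrow> q < n \<longrightarrow> r < n \<longrightarrow>
     cyc (a (i + p)) (a (i + q)) (a (i + r)) = cyc (a (i' + p)) (a (i' + q)) (a (i' + r)))"

text \<open>The cyclic order is \<open>x1\<close>, \<open>x0\<close>, \<open>x2\<close>,
  \<open>xn\<close>, so \<open>x2\<close> splits the arc from \<open>x0\<close> up to
  \<open>xn\<close>. A question about both end points reduces to questions about one of
  them.\<close>

lemma cyc_via:
  assumes "cyc x1 x0 x2" "cyc x2 xn x1" "x \<noteq> x0" "x \<noteq> xn"
  shows "cyc x0 x xn \<longleftrightarrow> x = x2 \<or> cyc x0 x x2 \<or> cyc x2 x xn"
  using assms unfolding cyc_def by (smt (verit))

text \<open>Two pairs of points on a circle separate each other or neither does: \<open>x1\<close>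
  and \<open>x2\<close> do not separate \<open>x0\<close> from \<open>xn\<close>, hence they lie on
  the same side of that pair.\<close>

lemma cyc_same_gap:
  assumes "cyc x1 x0 x2 = cyc x1 xn x2" "x1 \<noteq> x2" "x0 \<noteq> x1" "x0 \<noteq> x2" "xn \<noteq> x1" "xn \<noteq> x2" "x0 \<noteq> xn"
  shows "cyc x0 x1 xn = cyc x0 x2 xn"
  using assms unfolding cyc_def by (smt (verit))

lemma same_pattern_cyc:
  assumes "same_pattern a n i i'" "p < n" "q < n" "r < n"
  shows "cyc (a (i + p)) (a (i + q)) (a (i + r)) = cyc (a (i' + p)) (a (i' + q)) (a (i' + r))"
  using assms unfolding same_pattern_def cyc_def by blast

lemma same_pattern_shift: "same_pattern a (Suc n) i i' \<Longrightarrow> same_pattern a n (Suc i) (Suc i')"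
  unfolding same_pattern_def by (metis Suc_less_eq add_Suc_shift)

lemma cyc_invariantD:
  assumes "cyc_invariant a n" "p < n" "q < n" "r < n"
  shows "cyc (a (i + p)) (a (i + q)) (a (i + r)) = cyc (a (i' + p)) (a (i' + q)) (a (i' + r))"
  using assms unfolding cyc_invariant_def by blast

lemma cyc_invariant_uminus:
  assumes "inj a" "cyc_invariant a n"
  shows "cyc_invariant (\<lambda>i. - a i) n"
  unfolding cyc_invariant_def
proof (intro allI impI)
  fix i i' p q r assume "p < n" "q < n" "r < n"
  note eq = cyc_invariantD[OF assms(2) this, of i i']
  show "cyc (- a (i + p)) (- a (i + q)) (- a (i + r)) = cyc (- a (i' + p)) (- a (i' + q)) (- a (i' + r))"
  proof (cases "p \<noteq> q \<and> q \<noteq> r \<and> p \<noteq> r")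
    case True
    then show ?thesis
      using eq inj_eq[OF assms(1)] by (simp add: cyc_uminus)
  next
    case False
    then show ?thesis by (auto simp: cyc_def)
  qed
qed

text \<open>Triples missing \<open>n\<close> or missing 0 fit into a window of length
  \<open>n\<close> at \<open>i\<close> or at \<open>Suc i\<close>. A triple containing both is a
  rotation or reversal of the one in \<open>new\<close>.\<close>

lemma cyc_invariant_SucI:
  assumes inj: "inj a" and inv: "cyc_invariant a n"
    and new: "\<And>i i' q. 0 < q \<Longrightarrow> q < n \<Longrightarrow>
      cyc (a i) (a (i + q)) (a (i + n)) = cyc (a i') (a (i' + q)) (a (i' + n))"
  shows "cyc_invariant a (Suc n)"
  unfolding cyc_invariant_def
proof (intro allI impI)
  fix i i' p q r assume less: "p < Suc n" "q < Suc n" "r < Suc n"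
  let ?C = "\<lambda>p q r. cyc (a (i + p)) (a (i + q)) (a (i + r)) = cyc (a (i' + p)) (a (i' + q)) (a (i' + r))"
  have rot: "?C p q r \<longleftrightarrow> ?C q r p" for p q r using cyc_rotate by blast
  have swap: "?C p q r \<longleftrightarrow> ?C r q p" if "p \<noteq> q" "q \<noteq> r" "p \<noteq> r" for p q r
    using that inj_eq[OF inj] by (simp add: cyc_swap[of "a (i + p)"] cyc_swap[of "a (i' + p)"])
  have new': "?C 0 q n" if "q \<noteq> 0" "q < Suc n" "q \<noteq> n" for q
    using new[of q i i'] that by simp
  consider "p = q \<or> q = r \<or> p = r" | "p \<noteq> n" "q \<noteq> n" "r \<noteq> n" | "p \<noteq> 0" "q \<noteq> 0" "r \<noteq> 0"
    | "p \<noteq> q" "q \<noteq> r" "p \<noteq> r" "p = n \<or> q = n \<or> r = n" "p = 0 \<or> q = 0 \<or> r = 0" by argo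
  then show "?C p q r"
  proof cases
    case 1
    then show ?thesis by (auto simp: cyc_def)
  next
    case 2
    then show ?thesis using less cyc_invariantD[OF inv] by simp
  next
    case 3
    then show ?thesis
      using less cyc_invariantD[OF inv, of "p - 1" "q - 1" "r - 1" "Suc i" "Suc i'"] by simp
  next
    case 4
    moreover have "n \<noteq> 0" using less 4 by linarith
    ultimately consider "p = 0" "r = n" | "q = 0" "p = n" | "r = 0" "q = n"
      | "r = 0" "p = n" | "q = 0" "r = n" | "p = 0" "q = n" by metis
    then show ?thesis
    proof cases
      case 1 then show ?thesis using new'[of q] 4 less by simp
    next
      case 2 then show ?thesis using new'[of r] rot[of n 0 r] 4 less by simp
    next
      case 3 then show ?thesis using new'[of p] rot[of 0 p n] 4 less by simp
    next
      case 4 then show ?thesis using new'[of q] swap[of n q 0] \<open>p \<noteq> q\<close> \<open>q \<noteq> r\<close> \<open>p \<noteq> r\<close> less by simp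
    next
      case 5 then show ?thesis using new'[of p] swap[of n p 0] rot[of n p 0] 4 less by simp
    next
      case 6 then show ?thesis using new'[of r] swap[of n r 0] rot[of 0 n r] 4 less by simp
    qed
  qed
qed

section \<open>From windows of length \<open>n\<close> to windows of length
  \<open>n + 1\<close>\<close>

context minimal_perm
begin

text \<open>Here \<open>i\<close> and \<open>i + n\<close> are neighbours in the cyclic order of every window of length \<open>n + 1\<close>, and
  \<open>E i\<close> says on which side of \<open>i\<close> the new element lies.\<close>

lemma neighbour_side_constant:
  assumes n: "2 \<le> n" and inv: "cyc_invariant a n"
    and adj: "\<And>i q. 0 < q \<Longrightarrow> q < n \<Longrightarrow> cyc (a i) (a (i + q)) (a (i + n)) = E i"
    and new_min: "\<And>i. window_min a (Suc n) i n \<Longrightarrow> E i"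
  shows "E i"
proof -
  have E_cong: "E i = E i'" if "window_min a (Suc n) i j" "window_min a (Suc n) i' j" for i i' j
    using same_pattern_cyc[OF window_min_pattern[OF that], of 0 1 n] adj[of 1 i] adj[of 1 i'] n by simp
  have "\<exists>J. \<forall>i. window_min a n i (J i)" using window_min_exists[OF inj, of n] n by (intro choice) simp
  then obtain J where J: "\<And>i. window_min a n i (J i)" by blast
  have J_eq: "window_min a n i j \<Longrightarrow> J i = j" for i j using J window_min_unique by blast
  have dich: "window_min a (Suc n) i (J i) \<or> window_min a (Suc n) i n" for i
    using window_min_Suc_window[OF J] window_min_new[OF J] neq[of "i + J i" "i + n"] window_min_less[OF J[of i]]
    by (metis add_left_cancel less_irrefl linorder_neqE_linordered_idom)
  \<comment> \<open>If the incoming element were the new minimum, \<open>E i\<close> would place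
    \<open>i\<close> directly above it, making \<open>i\<close> the old minimum.\<close>
  have stay: "window_min a (Suc n) i (J i)" if "J i \<noteq> 0" for i
  proof (rule ccontr)
    assume "\<not> ?thesis"
    then have min: "window_min a (Suc n) i n" using dich by blast
    have "J i < n" using J window_min_less by blast
    then have "cyc (a i) (a (i + J i)) (a (i + n))" using new_min[OF min] adj that by simp
    moreover have "a (i + J i) < a i" using window_minD[OF J, of 0] that n by fastforce
    moreover have "a (i + n) < a (i + J i)" using window_minD[OF min, of "J i"] \<open>J i < n\<close> by simp
    ultimately show False by (auto simp: cyc_def)
  qed
  have down: "J (Suc i) = j" if "J i = Suc j" for i j
    using J_eq[OF window_min_shift] stay[of i] that by simp
  obtain i0 where i0: "window_min a (Suc n) i0 0" using window_min_recurrent[of 0 "Suc n"] by blast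
  have new_last: "J (Suc i) = n - 1" if "window_min a (Suc n) i n" for i
    using J_eq[OF window_min_shift[of a n i "n - 1"]] that n by simp
  have "E i0"
  proof (rule ccontr)
    \<comment> \<open>Whenever the minimum is first in its window, the incoming element is then
      directly above or below it, so the next minimum is last. Offset 1 thus recurs with period
      \<open>n\<close>, and its positions form a monotone chain.\<close>
    assume "\<not> E i0"
    have reset: "J (Suc i) = n - 1" if "J i = 0" for i
    proof (cases "window_min a (Suc n) i 0")
      case True
      have "a (i + n) < a (i + q)" if "0 < q" "q < n" for q
      proof -
        have "\<not> cyc (a i) (a (i + q)) (a (i + n))" using E_cong[OF i0 True] \<open>\<not> E i0\<close> adj that by simp
        moreover have "a i < a (i + q)" using window_minD[OF True, of q] that by simp
        ultimately show ?thesis using neq[of "i + q" "i + n"] that by (auto simp: cyc_def)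
      qed
      note last = this
      have "window_min a n (Suc i) (n - 1)"
        unfolding window_min_def
      proof (intro conjI allI impI)
        fix k assume "k < n" "k \<noteq> n - 1"
        then show "a (Suc i + (n - 1)) < a (Suc i + k)" using last[of "Suc k"] n by simp
      qed (use n in simp)
      then show ?thesis by (rule J_eq)
    next
      case False
      then show ?thesis using dich[of i] that new_last by metis
    qed
    obtain i1 where i1: "window_min a n i1 1" using window_min_recurrent[of 1 n] n by auto
    let ?S = "{i. J i = 1}"
    have ret: "J (i + n) = 1" if "J i = 1" for i
    proof -
      have "J (Suc (Suc i)) = n - 1" using down[of i 0] that reset by simp
      also have "\<dots> = (n - 2) + 1" using n by simp
      finally have "J (Suc (Suc i) + (n - 2)) = 1" using countdown[of J, OF down] by blast
      moreover have "Suc (Suc i) + (n - 2) = i + n" using n by simp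
      ultimately show ?thesis by metis
    qed
    have dir: "a i < a (i + n) \<longleftrightarrow> a i1 < a (i1 + n)" if "J i = 1" for i
    proof -
      have "same_pattern a (Suc n) i i1"
        using window_min_pattern[of "Suc n" i 1 i1] stay[of i] stay[of i1] that J_eq[OF i1] by simp
      then show ?thesis unfolding same_pattern_def by (metis add.right_neutral lessI zero_less_Suc)
    qed
    have ne: "?S \<noteq> {}" using J_eq[OF i1] by blast
    show False
    proof (cases "a i1 < a (i1 + n)")
      case True
      then have "rising a n ?S"
        unfolding rising_def using ret dir n by (intro ballI bexI[of _ n]) auto
      then show False using not_rising ne by blast
    next
      case False
      have "a (i + n) < a i" if "J i = 1" for i
        using dir[OF that] False neq[of i "i + n"] n by auto
      then have "rising (\<lambda>i. - a i) n ?S"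
        unfolding rising_def using ret n by (intro ballI bexI[of _ n]) auto
      then show False using not_falling ne by blast
    qed
  qed
  \<comment> \<open>The second lowest element of the window of length \<open>n + 1\<close> at
    \<open>i0\<close> is \<open>i0 + y\<close>. It differs from \<open>i0 + n\<close>, which
    \<open>E i0\<close> places at the top.\<close>
  define y where "y = Suc (J (Suc i0))"
  have i0_less: "a i0 < a (i0 + q)" if "0 < q" "q \<le> n" for q
    using window_minD[OF i0, of q] that by simp
  have y: "0 < y" "y < n"
  proof -
    show "0 < y" by (simp add: y_def)
    have "cyc (a i0) (a (i0 + 1)) (a (i0 + n))" using \<open>E i0\<close> adj[of 1 i0] n by simp
    then have "a (i0 + 1) < a (i0 + n)" using i0_less[of n] i0_less[of 1] n by (auto simp: cyc_def)
    moreover have "a (i0 + n) < a (i0 + 1)" if "J (Suc i0) = n - 1"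
      using window_minD[OF J[of "Suc i0"], of 0] that n by simp
    ultimately have "J (Suc i0) \<noteq> n - 1" by auto
    moreover have "J (Suc i0) < n" using J window_min_less by blast
    ultimately show "y < n" unfolding y_def by linarith
  qed
  have reset: "J (Suc i) = n - 1 \<or> J (Suc i) = y - 1" if "J i = 0" for i
  proof (cases "window_min a (Suc n) i 0")
    case True
    have "window_min a n (Suc i) (y - 1)"
      using same_pattern_window_min[OF same_pattern_shift[OF window_min_pattern[OF i0 True]] J]
      by (simp add: y_def)
    then show ?thesis using J_eq by blast
  next
    case False
    then show ?thesis using dich[of i] that new_last by metis
  qed
  have y_next: "\<not> cyc (a i0) (a (i0 + q)) (a (i0 + y))" if "q < n" for q
  proof -
    have "a (i0 + y) \<le> a (i0 + q)" if "0 < q"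
    proof (cases "q = y")
      case False
      then have "q - 1 \<noteq> J (Suc i0)" "q - 1 < n" using that \<open>q < n\<close> by (auto simp: y_def)
      from window_minD[OF J this(2,1)] show ?thesis using that by (simp add: y_def)
    qed simp
    then show ?thesis using i0_less[of q] i0_less[of y] that y by (cases "q = 0") (auto simp: cyc_def)
  qed
  \<comment> \<open>By invariance \<open>i + y\<close> directly follows \<open>i\<close> in the
    cyclic order of every window of length \<open>n\<close>. The value can drop only by wrapping
    around to the minimum, which then has offset \<open>y\<close>.\<close>
  have up_y: "a i < a (i + y)" if "J i \<noteq> y" for i
  proof (rule ccontr)
    assume "\<not> ?thesis"
    then have less: "a (i + y) < a i" using neq[of i "i + y"] y by auto
    moreover have "a (i + J i) < a (i + y)" using window_minD[OF J y(2)] that by metis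
    ultimately have "cyc (a i) (a (i + J i)) (a (i + y))" by (auto simp: cyc_def)
    moreover have "J i < n" using J window_min_less by blast
    ultimately show False
      using cyc_invariantD[OF inv, of 0 "J i" y i i0] y_next[of "J i"] y by simp
  qed
  show "E i"
  proof (rule ccontr)
    assume "\<not> E i"
    obtain j where j: "window_min a (Suc n) i j" using window_min_exists[OF inj] by blast
    have "j \<noteq> n" using new_min j \<open>\<not> E i\<close> by blast
    then have jn: "j < n" using window_min_less[OF j] by simp
    have j0: "0 < j" using E_cong[OF i0, of i] j \<open>E i0\<close> \<open>\<not> E i\<close> by (cases j) auto
    \<comment> \<open>With \<open>E\<close> false, \<open>i' + n\<close> directly follows
      \<open>i'\<close>; both lie above the minimum at offset \<open>j\<close>, so there is no
      wrap-around between them.\<close>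
    have up_n: "a i' < a (i' + n)" if "J i' = j" for i'
    proof -
      have min: "window_min a (Suc n) i' j" using stay[of i'] that j0 by simp
      then have "\<not> cyc (a i') (a (i' + j)) (a (i' + n))" using E_cong[OF j] \<open>\<not> E i\<close> adj j0 jn by simp
      moreover have "a (i' + j) < a i'" "a (i' + j) < a (i' + n)"
        using window_minD[OF min, of 0] window_minD[OF min, of n] j0 jn by auto
      ultimately show ?thesis using neq[of i' "i' + n"] n by (auto simp: cyc_def)
    qed
    have top: "\<exists>i\<ge>N. J i = n - 1" for N
      using window_min_recurrent[of "n - 1" n N] J_eq n by auto
    obtain S where "S \<noteq> {}" "rising a n S"
      using countdown_rising[of J n y j a, OF down reset y j0 jn top up_n up_y] by blast
    then show False using not_rising by blast
  qed
qed

text \<open>Either two inner positions separate \<open>i\<close> from \<open>i + n\<close>, and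
  everything is inherited from windows of length \<open>n\<close>, or the two are neighbours and the
  side has to be shown constant.\<close>

lemma cyc_invariant_Suc:
  assumes n: "2 \<le> n" and inv: "cyc_invariant a n"
  shows "cyc_invariant a (Suc n)"
proof (rule cyc_invariant_SucI[OF inj inv])
  fix i i' q assume q: "0 < q" "q < n"
  have inv0: "cyc (a (i + p)) (a i) (a (i + r)) = cyc (a (i' + p)) (a i') (a (i' + r))"
    if "p < n" "r < n" for p r i i'
    using cyc_invariantD[OF inv, of p 0 r i i'] that by simp
  have invn: "cyc (a (i + p)) (a (i + n)) (a (i + r)) = cyc (a (i' + p)) (a (i' + n)) (a (i' + r))"
    if "0 < p" "0 < r" "p < n" "r < n" for p r i i'
    using cyc_invariantD[OF inv, of "p - 1" "n - 1" "r - 1" "Suc i" "Suc i'"] that by simp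
  show "cyc (a i) (a (i + q)) (a (i + n)) = cyc (a i') (a (i' + q)) (a (i' + n))"
  proof (cases "\<exists>p r. 0 < p \<and> p < n \<and> 0 < r \<and> r < n \<and>
      cyc (a (i + p)) (a i) (a (i + r)) \<and> cyc (a (i + r)) (a (i + n)) (a (i + p))")
    case True
    then obtain p r where pr: "0 < p" "p < n" "0 < r" "r < n"
      and c: "cyc (a (i + p)) (a i) (a (i + r))" "cyc (a (i + r)) (a (i + n)) (a (i + p))" by blast
    have c': "cyc (a (i' + p)) (a i') (a (i' + r))" "cyc (a (i' + r)) (a (i' + n)) (a (i' + p))"
      using c inv0[of p r i i'] invn[of r p i i'] pr by auto
    have "cyc (a i) (a (i + q)) (a (i + n)) \<longleftrightarrow> a (i + q) = a (i + r) \<or>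
        cyc (a i) (a (i + q)) (a (i + r)) \<or> cyc (a (i + r)) (a (i + q)) (a (i + n))"
      by (rule cyc_via[OF c]) (use neq q in auto)
    moreover have "cyc (a i') (a (i' + q)) (a (i' + n)) \<longleftrightarrow> a (i' + q) = a (i' + r) \<or>
        cyc (a i') (a (i' + q)) (a (i' + r)) \<or> cyc (a (i' + r)) (a (i' + q)) (a (i' + n))"
      by (rule cyc_via[OF c']) (use neq q in auto)
    moreover have "cyc (a i) (a (i + q)) (a (i + r)) = cyc (a i') (a (i' + q)) (a (i' + r))"
      using inv0[of r q i i'] q pr cyc_rotate by metis
    moreover have "cyc (a (i + r)) (a (i + q)) (a (i + n)) = cyc (a (i' + r)) (a (i' + q)) (a (i' + n))"
      using invn[of q r i i'] q pr cyc_rotate by metis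
    moreover have "a (i + q) = a (i + r) \<longleftrightarrow> a (i' + q) = a (i' + r)"
      using inj_eq[OF inj] by simp
    ultimately show ?thesis by simp
  next
    case False
    have gap: "cyc (a (i + p)) (a i) (a (i + r)) = cyc (a (i + p)) (a (i + n)) (a (i + r))"
      if "0 < p" "p < n" "0 < r" "r < n" "p \<noteq> r" for p r
    proof -
      have "cyc (a (i + r)) (a (i + n)) (a (i + p)) \<longleftrightarrow> \<not> cyc (a (i + p)) (a (i + n)) (a (i + r))"
        "cyc (a (i + r)) (a i) (a (i + p)) \<longleftrightarrow> \<not> cyc (a (i + p)) (a i) (a (i + r))"
        by (rule cyc_swap; use that neq in simp)+
      then show ?thesis using False that by blast
    qed
    have "cyc (a k) (a (k + p)) (a (k + n)) = cyc (a k) (a (k + 1)) (a (k + n))"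
      if "0 < p" "p < n" for p k
    proof (cases "p = 1")
      case False
      have "cyc (a (k + p)) (a k) (a (k + 1)) = cyc (a (k + p)) (a (k + n)) (a (k + 1))"
        using gap[of p 1] inv0[of p 1 i k] invn[of p 1 i k] that False n by simp
      then show ?thesis
        by (rule cyc_same_gap) (use neq that False n in auto)
    qed simp
    note adj = this
    define E where "E k = cyc (a k) (a (k + 1)) (a (k + n))" for k
    have E: "cyc (a k) (a (k + p)) (a (k + n)) = E k" if "0 < p" "p < n" for p k
      using adj[OF that] by (simp add: E_def)
    \<comment> \<open>The first two cases are mirror images under negation. The third, where a new
      minimum and a new maximum both lie on the wrong side, is contradictory.\<close>
    consider "\<And>k. window_min a (Suc n) k n \<Longrightarrow> E k"
      | "\<And>k. window_min (\<lambda>i. - a i) (Suc n) k n \<Longrightarrow> \<not> E k"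
      | k k' where "window_min a (Suc n) k n" "\<not> E k" "window_min (\<lambda>i. - a i) (Suc n) k' n" "E k'"
      by blast
    then have "E i = E i'"
    proof cases
      case 1
      then show ?thesis using neighbour_side_constant[OF n inv E] by blast
    next
      case 2
      interpret neg: minimal_perm "\<lambda>i. - a i" using minimal_perm_uminus minimal_perm_axioms .
      have "cyc (- a k) (- a (k + p)) (- a (k + n)) = (\<not> E k)" if "0 < p" "p < n" for p k
        using cyc_uminus[of "a k" "a (k + p)" "a (k + n)"] E[OF that] neq that by simp
      then show ?thesis
        using neg.neighbour_side_constant[OF n cyc_invariant_uminus[OF inj inv], of "\<lambda>k. \<not> E k"] 2 by blast
    next
      case (3 k k')
      have max_k: "a (k + p) < a k" if "0 < p" "p < n" for p
        using E[of p k] 3(2) that window_minD[OF 3(1), of 0] window_minD[OF 3(1), of p] neq[of k "k + p"]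
        by (auto simp: cyc_def)
      have "a (k + n) < a k" using window_minD[OF 3(1), of 0] n by simp
      then have zero_max: "window_min (\<lambda>i. - a i) (Suc n) k 0"
        using max_k by (auto simp: window_min_def less_Suc_eq)
      obtain g where g: "window_min a n k g" using window_min_exists[OF inj] n by fastforce
      \<comment> \<open>The window at \<open>l\<close> agrees with that at \<open>k\<close> on
        length \<open>n\<close> but keeps its minimum there. If \<open>l + n\<close> is a new
        maximum, \<open>l\<close> inherits the side of \<open>k'\<close>, which is impossible
        directly above \<open>l\<close>; otherwise \<open>l\<close> is the maximum and the pattern
        of \<open>k\<close> forces the minimum to offset \<open>n\<close>.\<close>
      obtain l where l: "window_min a (Suc n) l g"
        using window_min_recurrent[of g "Suc n"] window_min_less[OF g] by auto
      have "same_pattern a n k l"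
        using window_min_pattern[OF g window_min_subwindow[OF l window_min_less[OF g]]] .
      then have max_l: "a (l + p) < a l" if "0 < p" "p < n" for p
        using max_k[OF that] that n unfolding same_pattern_def by (metis add.right_neutral order.strict_trans)
      show ?thesis
      proof (cases "a l < a (l + n)")
        case True
        have "a (l + p) < a (l + n)" if "p < n" for p
          using max_l[of p] True that by (cases "p = 0") auto
        then have "window_min (\<lambda>i. - a i) (Suc n) l n"
          by (auto simp: window_min_def less_Suc_eq)
        then have "E l"
          using same_pattern_cyc[OF window_max_pattern[OF 3(3)], of l 0 1 n] 3(4) n by (simp add: E_def)
        then show ?thesis using True max_l[of 1] n by (auto simp: E_def cyc_def)
      next
        case False
        then have "a (l + n) < a l" using neq[of l "l + n"] n by auto
        then have "window_min (\<lambda>i. - a i) (Suc n) l 0"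
          using max_l by (auto simp: window_min_def less_Suc_eq)
        then have "window_min a (Suc n) l n"
          using same_pattern_window_min[OF window_max_pattern[OF zero_max]] 3(1) by blast
        then show ?thesis using window_min_unique[OF l] window_min_less[OF g] by blast
      qed
    qed
    then show ?thesis using E[OF q] by simp
  qed
qed

text \<open>Induction on the window length starts at 2, where no three positions are distinct;
  length \<open>i + j + k + 2\<close> is enough for the given triple.\<close>

lemma cyc_shift: "cyc (a (Suc i)) (a (Suc j)) (a (Suc k)) = cyc (a i) (a j) (a k)"
proof -
  have inv: "cyc_invariant a (m + 2)" for m
  proof (induction m)
    case 0
    have "\<not> cyc (a (i + p)) (a (i + q)) (a (i + r))" if "p < 2" "q < 2" "r < 2" for i p q r :: nat
    proof -
      have "p = q \<or> q = r \<or> p = r" using that by linarith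
      then show ?thesis by (auto simp: cyc_def)
    qed
    then show ?case by (simp add: cyc_invariant_def)
  next
    case (Suc m)
    then show ?case using cyc_invariant_Suc[of "m + 2"] by simp
  qed
  show ?thesis
    using cyc_invariantD[OF inv[of "i + j + k"], of i j k 1 0] by simp
qed

end

subsection \<open>Arc lengths as frequencies\<close>

lemma density_perturb:
  fixes c c' :: "nat \<Rightarrow> nat"
  assumes "(\<lambda>n. real (c n) / real n) \<longlonglongrightarrow> L" "\<And>n. c n \<le> Suc (c' n)" "\<And>n. c' n \<le> Suc (c n)"
  shows "(\<lambda>n. real (c' n) / real n) \<longlonglongrightarrow> L"
proof -
  have "(\<lambda>n. (real (c' n) - real (c n)) / real n) \<longlonglongrightarrow> 0"
  proof (rule tendsto_0_le[OF lim_const_over_n[of 1], where K = 1], rule always_eventually, rule allI)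
    fix n
    have "\<bar>real (c' n) - real (c n)\<bar> \<le> 1" using assms(2,3)[of n] by linarith
    then show "norm ((real (c' n) - real (c n)) / real n) \<le> norm (1 / real n) * 1"
      by (simp add: divide_right_mono)
  qed
  from tendsto_add[OF assms(1) this] show ?thesis by (simp add: diff_divide_distrib)
qed

lemma card_mono_insert:
  assumes "A \<subseteq> insert x B" "finite B"
  shows "card A \<le> Suc (card B)"
proof -
  have "card A \<le> card (insert x B)" using assms by (intro card_mono) auto
  also have "\<dots> \<le> Suc (card B)" by (rule card_insert_le_m1) auto
  finally show ?thesis .
qed

lemma density_cong:
  assumes "(\<lambda>n. real (card {k. k < n \<and> P k}) / real n) \<longlonglongrightarrow> L" "\<And>k. k \<noteq> i \<Longrightarrow> P k = Q k"
  shows "(\<lambda>n. real (card {k. k < n \<and> Q k}) / real n) \<longlonglongrightarrow> L"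
  by (rule density_perturb[OF assms(1)]; rule card_mono_insert[where x = i]; use assms(2) in auto)

lemma density_not:
  assumes "(\<lambda>n. real (card {k. k < n \<and> P k}) / real n) \<longlonglongrightarrow> L"
  shows "(\<lambda>n. real (card {k. k < n \<and> \<not> P k}) / real n) \<longlonglongrightarrow> 1 - L"
proof -
  have "\<forall>\<^sub>F n in sequentially. 1 - real (card {k. k < n \<and> P k}) / real n
      = real (card {k. k < n \<and> \<not> P k}) / real n"
    using eventually_gt_at_top[of 0]
  proof eventually_elim
    case (elim n)
    have "{..<n} = {k. k < n \<and> P k} \<union> {k. k < n \<and> \<not> P k}" by auto
    then have "card {..<n} = card {k. k < n \<and> P k} + card {k. k < n \<and> \<not> P k}"
      by (simp only:) (rule card_Un_disjoint, auto)
    then show ?case using elim by (simp add: field_simps)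
  qed
  moreover have "(\<lambda>n. 1 - real (card {k. k < n \<and> P k}) / real n) \<longlonglongrightarrow> 1 - L"
    by (intro tendsto_intros assms)
  ultimately show ?thesis by (simp add: tendsto_cong)
qed

text \<open>The limit is the length of the arc on a circle of circumference 1. An arc that wraps
  around is compared with the complement of a half-open interval; by injectivity the two differ at
  index \<open>i\<close> only.\<close>

lemma arc_frequency:
  assumes "inj a" "equidistributed_seq a" "i \<noteq> j"
  shows "(\<lambda>n. real (card {k. k < n \<and> cyc (a i) (a k) (a j)}) / real n)
    \<longlonglongrightarrow> (if a i < a j then a j - a i else 1 + a j - a i)"
proof -
  have neq: "a k \<noteq> a i" if "k \<noteq> i" for k using injD[OF assms(1)] that by blast
  show ?thesis
  proof (cases "a i < a j")
    case True
    have "(\<lambda>n. real (card {k. k < n \<and> a i \<le> a k \<and> a k < a j}) / real n) \<longlonglongrightarrow> a j - a i"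
      using True equidistributed_bounds[OF assms(2)] by (intro equidistributed_interval assms) auto
    then have "(\<lambda>n. real (card {k. k < n \<and> cyc (a i) (a k) (a j)}) / real n) \<longlonglongrightarrow> a j - a i"
    proof (rule density_cong)
      fix k assume "k \<noteq> i"
      then show "(a i \<le> a k \<and> a k < a j) = cyc (a i) (a k) (a j)"
        using True neq[of k] unfolding cyc_def by linarith
    qed
    then show ?thesis using True by simp
  next
    case False
    then have less: "a j < a i" using neq[of j] assms(3) by simp
    have "(\<lambda>n. real (card {k. k < n \<and> a j \<le> a k \<and> a k < a i}) / real n) \<longlonglongrightarrow> a i - a j"
      using less equidistributed_bounds[OF assms(2)] by (intro equidistributed_interval assms) auto
    then have "(\<lambda>n. real (card {k. k < n \<and> cyc (a i) (a k) (a j)}) / real n) \<longlonglongrightarrow> 1 - (a i - a j)"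
    proof (rule density_cong[OF density_not])
      fix k assume "k \<noteq> i"
      then show "(\<not> (a j \<le> a k \<and> a k < a i)) = cyc (a i) (a k) (a j)"
        using less neq[of k] unfolding cyc_def by linarith
    qed
    then show ?thesis using False by (simp add: algebra_simps)
  qed
qed

text \<open>The shift carries the arc from \<open>a 0\<close> to \<open>a j\<close> to the arc from
  \<open>a 1\<close> to \<open>a (Suc j)\<close>, up to one boundary index in each count. Equal
  frequencies give equal lengths, so the increments of \<open>a\<close> agree modulo 1.\<close>

lemma cyc_shift_imp_rotation:
  assumes "inj a" "equidistributed_seq a"
    and shift: "\<And>i j k. cyc (a (Suc i)) (a (Suc j)) (a (Suc k)) = cyc (a i) (a j) (a k)"
  shows "a n - (a 0 + real n * (a 1 - a 0)) \<in> \<int>"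
proof -
  have step: "a (Suc j) - a j - (a 1 - a 0) \<in> \<int>" for j
  proof (cases "j = 0")
    case False
    let ?A = "\<lambda>n. {k. k < n \<and> cyc (a 0) (a k) (a j)}" and ?B = "\<lambda>n. {k. k < n \<and> cyc (a 1) (a k) (a (Suc j))}"
    have "?B n \<subseteq> insert 0 (Suc ` ?A n)" for n
    proof
      fix k assume "k \<in> ?B n"
      then show "k \<in> insert 0 (Suc ` ?A n)" using shift[of 0 "k - 1" j] by (cases k) auto
    qed
    then have BA: "card (?B n) \<le> Suc (card (?A n))" for n
      using card_mono_insert[of "?B n" 0 "Suc ` ?A n"] by (simp add: card_image)
    have "Suc ` ?A n \<subseteq> insert n (?B n)" for n using shift[of 0 _ j] by auto
    then have AB: "card (?A n) \<le> Suc (card (?B n))" for n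
      using card_mono_insert[of "Suc ` ?A n" n "?B n"] by (simp add: card_image)
    have "(\<lambda>n. real (card (?B n)) / real n) \<longlonglongrightarrow> (if a 0 < a j then a j - a 0 else 1 + a j - a 0)"
      by (rule density_perturb[OF arc_frequency AB BA]) (use assms False in auto)
    moreover have "(\<lambda>n. real (card (?B n)) / real n) \<longlonglongrightarrow>
        (if a 1 < a (Suc j) then a (Suc j) - a 1 else 1 + a (Suc j) - a 1)"
      by (rule arc_frequency) (use assms False in auto)
    ultimately have "(if a 0 < a j then a j - a 0 else 1 + a j - a 0)
        = (if a 1 < a (Suc j) then a (Suc j) - a 1 else 1 + a (Suc j) - a 1)"
      by (rule LIMSEQ_unique)
    then have "a (Suc j) - a j - (a 1 - a 0) \<in> {0, 1, -1}" by (auto split: if_splits)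
    then show ?thesis by auto
  qed simp
  show ?thesis
  proof (induction n)
    case (Suc n)
    from Ints_add[OF this step[of n]] show ?case by (simp add: algebra_simps)
  qed simp
qed

subsection \<open>Rotations\<close>

lemma irrational_mult_not_int:
  assumes "\<sigma> \<notin> \<rat>" "i \<noteq> j"
  shows "(real i - real j) * \<sigma> \<notin> \<int>"
proof
  assume "(real i - real j) * \<sigma> \<in> \<int>"
  then have "(real i - real j) * \<sigma> / (real i - real j) \<in> \<rat>"
    by (intro Rats_divide Rats_diff Rats_of_nat) (use Ints_subset_Rats in blast)
  then show False using assms by simp
qed

lemma upper_frac_eq:
  assumes "x - y \<in> \<int>" "0 < y" "y \<le> 1"
  shows "upper_frac x = y"
proof -
  obtain z where z: "x - y = of_int z" using assms(1) by (auto elim: Ints_cases)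
  then have "\<lceil>x\<rceil> = z + 1" using assms by (intro ceiling_unique) auto
  then show ?thesis using z by (simp add: upper_frac_def)
qed

lemma upper_frac_bounds: "0 < upper_frac x" "upper_frac x \<le> 1" "upper_frac x - x \<in> \<int>"
proof -
  show "0 < upper_frac x" "upper_frac x \<le> 1" unfolding upper_frac_def by linarith+
  have "upper_frac x - x = of_int (1 - \<lceil>x\<rceil>)" by (simp add: upper_frac_def)
  then show "upper_frac x - x \<in> \<int>" by (metis Ints_of_int)
qed

text \<open>If 1 is not a value, fractional parts recover \<open>a\<close>. If it is, irrationality
  excludes the value 0 and upper fractional parts recover \<open>a\<close>.\<close>

lemma rotation_imp_sturmian:
  assumes "inj a" and bounds: "\<And>n. 0 \<le> a n" "\<And>n. a n \<le> 1"
    and rot: "\<And>n. a n - (a 0 + real n * \<delta>) \<in> \<int>"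
  shows "sturmian_perm (perm_of a)"
proof -
  have irrat: "\<delta> \<notin> \<rat>"
  proof
    assume "\<delta> \<in> \<rat>"
    then obtain p q where q: "0 < q" "\<delta> = of_int p / of_int q" by (auto elim: Rats_cases')
    \<comment> \<open>For rational \<open>\<delta>\<close>, \<open>a 0\<close>, \<open>a r\<close>
      and \<open>a (2 * r)\<close> are congruent modulo 1. Two such values could be the end points 0
      and 1, so a third is needed.\<close>
    define r where "r = nat q"
    have r: "0 < r" "real r * \<delta> = of_int p" using q by (auto simp: r_def)
    have unit: "a i - a j = 1 \<or> a i - a j = -1" if ij: "i \<noteq> j" and int: "a i - a j \<in> \<int>" for i j
    proof -
      obtain z :: int where z: "a i - a j = of_int z" using int by (auto elim: Ints_cases)
      have "a i \<noteq> a j" using injD[OF assms(1)] ij by blast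
      moreover have "-1 \<le> a i - a j" "a i - a j \<le> 1" using bounds[of i] bounds[of j] by linarith+
      ultimately have "z \<noteq> 0" "-1 \<le> z" "z \<le> 1" using z by auto
      then have "z = 1 \<or> z = -1" by linarith
      then show ?thesis using z by auto
    qed
    have 1: "a r - a 0 \<in> \<int>"
      using Ints_add[OF rot[of r] Ints_of_int[of p]] r by simp
    have 2: "a (2 * r) - a 0 \<in> \<int>"
      using Ints_add[OF rot[of "2 * r"] Ints_of_int[of "2 * p"]] r(2) by (simp add: mult.assoc)
    have 3: "a (2 * r) - a r \<in> \<int>" using Ints_diff[OF 2 1] by simp
    show False using unit[OF _ 1] unit[OF _ 2] unit[OF _ 3] r by auto
  qed
  define \<sigma> where "\<sigma> = frac \<delta>"
  have \<delta>: "\<delta> = \<sigma> + of_int \<lfloor>\<delta>\<rfloor>" by (simp add: \<sigma>_def frac_def)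
  have \<sigma>_irrat: "\<sigma> \<notin> \<rat>" using irrat \<delta> by (metis Rats_add Rats_of_int)
  have \<sigma>: "0 < \<sigma>" "\<sigma> < 1"
    using frac_ge_0[of \<delta>] frac_lt_1[of \<delta>] \<sigma>_irrat Rats_0 unfolding \<sigma>_def
    by (metis order_le_imp_less_or_eq, simp)
  have rot': "(a 0 + real n * \<sigma>) - a n \<in> \<int>" for n
  proof -
    have "(a 0 + real n * \<sigma>) - a n = - (a n - (a 0 + real n * \<delta>)) - of_int (int n * \<lfloor>\<delta>\<rfloor>)"
    proof -
      have "real n * \<delta> = real n * \<sigma> + real n * of_int \<lfloor>\<delta>\<rfloor>" using \<delta> by (metis distrib_left)
      then show ?thesis by simp
    qed
    then show ?thesis using rot[of n] by (metis Ints_diff Ints_minus Ints_of_int)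
  qed
  have rep: "is_representative a (perm_of a)" using assms(1) by (simp add: is_representative_def)
  show ?thesis
  proof (cases "\<forall>n. a n < 1")
    case True
    then have "frac (a 0 + real n * \<sigma>) = a n" for n
      using rot' bounds by (simp add: frac_unique_iff)
    then show ?thesis
      unfolding sturmian_perm_def using \<sigma> \<sigma>_irrat rep by (intro exI[of _ \<sigma>] exI[of _ "a 0"]) simp
  next
    case False
    then obtain k where k: "a k = 1" using bounds(2) by (meson antisym not_less)
    have pos: "0 < a n" for n
    proof (rule ccontr)
      assume "\<not> 0 < a n"
      then have n: "a n = 0" using bounds(1)[of n] by simp
      have "(real n - real k) * \<sigma> + 1 \<in> \<int>"
        using Ints_diff[OF rot'[of n] rot'[of k]] n k by (simp add: algebra_simps)
      then have "(real n - real k) * \<sigma> \<in> \<int>" using Ints_diff[OF _ Ints_1] by fastforce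
      moreover have "n \<noteq> k" using n k by auto
      ultimately show False using irrational_mult_not_int \<sigma>_irrat by blast
    qed
    have "upper_frac (a 0 + real n * \<sigma>) = a n" for n
      using rot' pos bounds by (intro upper_frac_eq) auto
    then show ?thesis
      unfolding sturmian_perm_def using \<sigma> \<sigma>_irrat rep by (intro exI[of _ \<sigma>] exI[of _ "a 0"]) simp
  qed
qed

text \<open>Above the window minimum at offset \<open>j\<close>, the element at offset
  \<open>k\<close> has height \<open>frac ((real k - real j) * \<sigma>)\<close>, independent of
  \<open>i\<close>. The bound \<open>diam\<close> covers both kinds of fractional part.\<close>

lemma rotation_complexity_le:
  assumes "inj a" and rot: "\<And>n. a n - (\<rho> + real n * \<sigma>) \<in> \<int>"
    and diam: "\<And>i j. a i - a j < 1" and "0 < n"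
  shows "complexity (perm_of a) n \<le> n"
proof (rule complexity_le[OF assms(1,4)])
  fix i i' j assume min: "window_min a n i j" "window_min a n i' j"
  have off: "a (i + k) = a (i + j) + frac ((real k - real j) * \<sigma>)" if "window_min a n i j" "k < n" for i k
  proof -
    have "a (i + j) \<le> a (i + k)"
      using window_minD[OF that(1), of k] that(2) by (cases "k = j") auto
    moreover have "(real k - real j) * \<sigma> - (a (i + k) - a (i + j)) \<in> \<int>"
      using Ints_diff[OF rot[of "i + j"] rot[of "i + k"]] by (simp add: algebra_simps)
    ultimately have "frac ((real k - real j) * \<sigma>) = a (i + k) - a (i + j)"
      using diam by (simp add: frac_unique_iff)
    then show ?thesis by simp
  qed
  show "same_pattern a n i i'"
    unfolding same_pattern_def using off[OF min(1)] off[OF min(2)] by simp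
qed

lemma sturmian_complexity_le:
  assumes "sturmian_perm \<alpha>" "0 < n"
  shows "complexity \<alpha> n \<le> n"
proof -
  obtain \<sigma> \<rho> where "is_representative (\<lambda>n. frac (\<rho> + real n * \<sigma>)) \<alpha> \<or>
       is_representative (\<lambda>n. upper_frac (\<rho> + real n * \<sigma>)) \<alpha>"
    using assms(1) unfolding sturmian_perm_def by blast
  then show ?thesis
  proof
    assume rep: "is_representative (\<lambda>n. frac (\<rho> + real n * \<sigma>)) \<alpha>"
    have "frac i - frac j < 1" for i j :: real
      using frac_lt_1[of i] frac_ge_0[of j] by linarith
    moreover have "frac x - x \<in> \<int>" for x :: real by (simp add: frac_def)
    ultimately show ?thesis
      using rotation_complexity_le[of "\<lambda>n. frac (\<rho> + real n * \<sigma>)" \<rho> \<sigma> n] rep assms(2)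
      by (auto simp: is_representative_def)
  next
    assume rep: "is_representative (\<lambda>n. upper_frac (\<rho> + real n * \<sigma>)) \<alpha>"
    have "upper_frac i - upper_frac j < 1" for i j :: real
      using upper_frac_bounds[of i] upper_frac_bounds[of j] by linarith
    then show ?thesis
      using rotation_complexity_le[of "\<lambda>n. upper_frac (\<rho> + real n * \<sigma>)" \<rho> \<sigma> n] rep assms(2)
        upper_frac_bounds(3)
      by (auto simp: is_representative_def)
  qed
qed

section \<open>Equidistribution of irrational rotations\<close>

lemma inj_on_progression_mod:
  fixes p m :: int
  assumes "coprime p (int q)" "0 < q"
  shows "inj_on (\<lambda>k. (m + int k * p) mod int q) {..<q}"
proof (rule inj_onI)
  fix k l assume kl: "k \<in> {..<q}" "l \<in> {..<q}"
    and "(m + int k * p) mod int q = (m + int l * p) mod int q"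
  then have "int q dvd (m + int k * p) - (m + int l * p)" by (simp add: mod_eq_dvd_iff)
  then have "int q dvd (int k - int l) * p" by (simp add: algebra_simps)
  then have "int q dvd int k - int l"
    using assms(1) by (simp add: coprime_commute coprime_dvd_mult_left_iff)
  moreover have "\<bar>int k - int l\<bar> < int q" using kl by auto
  ultimately have "int k - int l = 0" using zdvd_not_zless by (metis abs_of_nat dvd_imp_le_int not_le)
  then show "k = l" by simp
qed

text \<open>Modulo 1, the \<open>q\<close> points are within \<open>2/q\<close> of the multiples of \<open>1/q\<close>, each occurring once.\<close>

lemma rotation_block_count:
  fixes \<sigma> t y :: real and p :: int and q :: nat
  assumes cop: "coprime p (int q)" and q: "0 < q"
    and approx: "\<bar>\<sigma> - real_of_int p / real q\<bar> < 1 / (real q)\<^sup>2" and t: "0 \<le> t" "t \<le> 1"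
  shows "\<bar>real (card {k. k < q \<and> frac (y + real k * \<sigma>) < t}) - real q * t\<bar> \<le> 3"
proof -
  define m where "m = \<lfloor>real q * y\<rfloor>"
  define g where "g k = (m + int k * p) mod int q" for k
  have inj: "inj_on g {..<q}" unfolding g_def using inj_on_progression_mod[OF cop q] .
  have g: "0 \<le> g k" "g k < int q" for k using q by (auto simp: g_def)
  \<comment> \<open>The error, scaled by \<open>q\<close>, lies between -1 and 2: at most 1 from
    approximating \<open>\<sigma>\<close> and less than 1 from rounding \<open>real q * y\<close>
    down. Away from the residues 0 and \<open>q - 1\<close> it cannot cross an integer.\<close>
  have close: "real_of_int (g k) - 1 < real q * frac (y + real k * \<sigma>) \<and>
      real q * frac (y + real k * \<sigma>) < real_of_int (g k) + 2"
    if k: "k < q" and gk: "g k \<noteq> 0" "g k \<noteq> int q - 1" for k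
  proof -
    define e where "e = y + real k * \<sigma> - real_of_int (m + int k * p) / real q"
    have "\<bar>real k * (real q * \<sigma> - real_of_int p)\<bar> < 1"
    proof -
      have "\<bar>real q * \<sigma> - real_of_int p\<bar> = real q * \<bar>\<sigma> - real_of_int p / real q\<bar>"
        using q by (simp add: abs_mult_pos' right_diff_distrib)
      also have "\<dots> < real q * (1 / (real q)\<^sup>2)" using approx q by (intro mult_strict_left_mono) auto
      also have "\<dots> = 1 / real q" by (simp add: power2_eq_square)
      finally have "\<bar>real q * \<sigma> - real_of_int p\<bar> < 1 / real q" .
      then have "real k * \<bar>real q * \<sigma> - real_of_int p\<bar> \<le> real k * (1 / real q)"
        by (intro mult_left_mono) auto
      also have "\<dots> < 1" using k by simp
      finally show ?thesis by (simp add: abs_mult)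
    qed
    moreover have "real q * e = (real q * y - real_of_int m) + real k * (real q * \<sigma> - real_of_int p)"
      using q by (simp add: e_def field_simps)
    moreover have "0 \<le> real q * y - real_of_int m" "real q * y - real_of_int m < 1"
      unfolding m_def by linarith+
    ultimately have e: "-1 < real q * e" "real q * e < 2" by linarith+
    define f where "f = real_of_int (g k) / real q + e"
    have qf: "real q * f = real_of_int (g k) + real q * e" using q by (simp add: f_def field_simps)
    have "1 \<le> g k" "g k \<le> int q - 2" using g[of k] gk by linarith+
    then have "1 \<le> real_of_int (g k)" "real_of_int (g k) \<le> real q - 2" by linarith+
    then have "0 < real q * f" "real q * f < real q * 1" using qf e by linarith+
    then have f: "0 \<le> f" "f < 1" using q by (auto simp: zero_less_mult_iff)
    have "y + real k * \<sigma> - f = real_of_int ((m + int k * p) div int q)"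
    proof -
      have "m + int k * p = int q * ((m + int k * p) div int q) + g k" by (simp add: g_def)
      then have "real_of_int (m + int k * p) = real q * real_of_int ((m + int k * p) div int q) + real_of_int (g k)"
        by (metis of_int_add of_int_mult of_int_of_nat_eq)
      then show ?thesis using q by (simp add: f_def e_def field_simps)
    qed
    then have "frac (y + real k * \<sigma>) = f" using f by (simp add: frac_unique_iff)
    then show ?thesis using qf e by simp
  qed
  have count: "card A \<le> card B" if "g ` A \<subseteq> B" "A \<subseteq> {..<q}" "finite B" for A B
    using card_inj_on_le[OF inj_on_subset[OF inj that(2)] that(1,3)] .
  let ?A = "{k. k < q \<and> frac (y + real k * \<sigma>) < t}" and ?B = "{k. k < q \<and> \<not> frac (y + real k * \<sigma>) < t}"
  have "g ` ?A \<subseteq> {0..\<lceil>real q * t\<rceil>} \<union> {int q - 1}"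
  proof (rule image_subsetI, rule UnCI)
    fix k assume "k \<in> ?A" and "g k \<notin> {int q - 1}"
    then have k: "k < q" "frac (y + real k * \<sigma>) < t" "g k \<noteq> int q - 1" by auto
    show "g k \<in> {0..\<lceil>real q * t\<rceil>}"
    proof (cases "g k = 0")
      case False
      have "real q * frac (y + real k * \<sigma>) < real q * t" using k q by simp
      then have "real_of_int (g k) - 1 < real q * t" using close[OF k(1) False k(3)] by linarith
      then have "g k \<le> \<lceil>real q * t\<rceil>" by linarith
      then show ?thesis using g by simp
    next
      case True
      have "0 \<le> real q * t" using t by simp
      then show ?thesis using True by simp
    qed
  qed
  then have "card ?A \<le> card ({0..\<lceil>real q * t\<rceil>} \<union> {int q - 1})" by (rule count) auto
  also have "\<dots> \<le> nat (\<lceil>real q * t\<rceil> + 1) + 1" by (rule order.trans[OF card_Un_le]) simp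
  finally have cA: "card ?A \<le> nat (\<lceil>real q * t\<rceil> + 1) + 1" .
  have "0 \<le> real q * t" using t by simp
  then have "0 \<le> \<lceil>real q * t\<rceil>" by linarith
  then have "real (card ?A) \<le> real_of_int \<lceil>real q * t\<rceil> + 2" using cA by linarith
  then have upper: "real (card ?A) \<le> real q * t + 3" by linarith
  \<comment> \<open>The lower bound for \<open>?A\<close> comes from an upper bound for its
    complement, with 0 as the exceptional residue.\<close>
  have "g ` ?B \<subseteq> {\<lfloor>real q * t\<rfloor> - 1..int q - 1} \<union> {0}"
  proof (rule image_subsetI, rule UnCI)
    fix k assume "k \<in> ?B" and "g k \<notin> {0}"
    then have k: "k < q" "\<not> frac (y + real k * \<sigma>) < t" "g k \<noteq> 0" by auto
    show "g k \<in> {\<lfloor>real q * t\<rfloor> - 1..int q - 1}"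
    proof (cases "g k = int q - 1")
      case True
      have "real q * t \<le> real q" using t q by (simp add: mult_left_le)
      then show ?thesis using True by simp linarith
    next
      case False
      have "real q * t \<le> real q * frac (y + real k * \<sigma>)" using k q by simp
      then have "real q * t < real_of_int (g k) + 2" using close[OF k(1) k(3) False] by linarith
      then have "\<lfloor>real q * t\<rfloor> - 1 \<le> g k" by linarith
      then show ?thesis using g[of k] by simp
    qed
  qed
  then have "card ?B \<le> card ({\<lfloor>real q * t\<rfloor> - 1..int q - 1} \<union> {0})" by (rule count) auto
  also have "\<dots> \<le> nat (int q - 1 - (\<lfloor>real q * t\<rfloor> - 1) + 1) + 1" by (rule order.trans[OF card_Un_le]) simp
  finally have cB: "card ?B \<le> nat (int q - 1 - (\<lfloor>real q * t\<rfloor> - 1) + 1) + 1" .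
  have "real q * t \<le> real q" using t q by (simp add: mult_left_le)
  then have "\<lfloor>real q * t\<rfloor> \<le> int q" by linarith
  then have "real (card ?B) \<le> real q - real_of_int \<lfloor>real q * t\<rfloor> + 2" using cB by linarith
  then have "real (card ?B) \<le> real q - real q * t + 3" by linarith
  moreover have "card ?A + card ?B = q"
  proof -
    have "card (?A \<union> ?B) = card ?A + card ?B" by (rule card_Un_disjoint) auto
    moreover have "?A \<union> ?B = {..<q}" by auto
    ultimately show ?thesis by simp
  qed
  ultimately show ?thesis using upper by linarith
qed

lemma card_less_add:
  "card {i. i < (s::nat) + q \<and> P i} = card {i. i < s \<and> P i} + card {k. k < q \<and> P (s + k)}"
proof -
  have "{i. i < s + q \<and> P i} = {i. i < s \<and> P i} \<union> (+) s ` {k. k < q \<and> P (s + k)}"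
    by (auto simp: image_iff) (metis le_Suc_ex nat_add_left_cancel_less not_less)
  moreover have "card (\<dots>) = card {i. i < s \<and> P i} + card ((+) s ` {k. k < q \<and> P (s + k)})"
    by (rule card_Un_disjoint) auto
  ultimately show ?thesis by (simp add: card_image)
qed

text \<open>An irrational number has rational approximations with arbitrarily large denominator
  \<open>q\<close>. Each block of \<open>q\<close> points has discrepancy at most 3, so the relative
  error is at most \<open>3 / q\<close> plus the share of one incomplete block.\<close>

lemma equidistributed_rotation:
  fixes \<sigma> :: real
  assumes "\<sigma> \<notin> \<rat>"
  shows "equidistributed_seq (\<lambda>n. frac (\<rho> + real n * \<sigma>))"
  unfolding equidistributed_seq_def
proof (intro conjI allI ballI)
  show "frac (\<rho> + real n * \<sigma>) \<in> {0..1}" for n using frac_lt_1[of "\<rho> + real n * \<sigma>"] by simp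
next
  fix t :: real assume t: "t \<in> {0..1}"
  define N where "N n = card {i. i < n \<and> frac (\<rho> + real i * \<sigma>) < t}" for n
  have "(\<lambda>n. real (N n) / real n) \<longlonglongrightarrow> t"
  proof (rule LIMSEQ_I)
    fix \<epsilon> :: real assume "0 < \<epsilon>"
    have "infinite (approx_set \<sigma>)" using assms rational_iff_finite_approx_set by blast
    then obtain p q' where pq': "(p, q') \<in> approx_set \<sigma>" "q' > max 0 \<lceil>6 / \<epsilon>\<rceil>"
      using infinite_approx_set by blast
    define q where "q = nat q'"
    have q: "q > 0" "int q = q'" "real q = real_of_int q'" using pq' by (auto simp: q_def)
    have "6 / \<epsilon> < real q" using pq'(2) q by linarith
    then have q\<epsilon>: "3 / real q < \<epsilon> / 2" using \<open>0 < \<epsilon>\<close> q(1) by (simp add: field_simps)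
    have cop: "coprime p (int q)" and approx: "\<bar>\<sigma> - real_of_int p / real q\<bar> < 1 / (real q)\<^sup>2"
      using pq'(1) unfolding q(2,3) by (auto simp: approx_set_def)
    have block: "\<bar>real (N (s + q)) - real (N s) - real q * t\<bar> \<le> 3" for s
      using rotation_block_count[OF cop q(1) approx, of t "\<rho> + real s * \<sigma>"] t
      by (simp add: N_def card_less_add[of s q] distrib_right add.assoc)
    have blocks: "\<bar>real (N (b * q)) - real (b * q) * t\<bar> \<le> 3 * real b" for b
    proof (induction b)
      case (Suc b)
      then show ?case using block[of "b * q"] by (simp add: algebra_simps)
    qed (simp add: N_def)
    have bound: "\<bar>real (N n) - real n * t\<bar> \<le> 3 * (real n / real q) + real q" for n
    proof -
      define b r where "b = n div q" and "r = n mod q"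
      have n: "n = b * q + r" "r < q" using q by (auto simp: b_def r_def)
      have "card {k. k < r \<and> frac (\<rho> + real (b * q + k) * \<sigma>) < t} \<le> card {..<r}" by (rule card_mono) auto
      then have "N (b * q) \<le> N n" "N n \<le> N (b * q) + r" using n by (auto simp: N_def card_less_add)
      moreover have "0 \<le> real r * t" "real r * t \<le> real r" using t by (auto simp: mult_left_le)
      moreover have "real n * t = real (b * q) * t + real r * t" using n by (simp add: algebra_simps)
      moreover have "real b \<le> real n / real q" using n q(1) by (simp add: field_simps)
      ultimately show ?thesis using blocks[of b] n(2) by linarith
    qed
    obtain M :: nat where M: "2 * real q / \<epsilon> < real M" using reals_Archimedean2 by blast
    show "\<exists>no. \<forall>n\<ge>no. norm (real (N n) / real n - t) < \<epsilon>"
    proof (intro exI allI impI)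
      fix n assume "n \<ge> M"
      then have n: "2 * real q / \<epsilon> < real n" using M by linarith
      moreover have "0 < 2 * real q / \<epsilon>" using q \<open>0 < \<epsilon>\<close> by simp
      ultimately have n0: "0 < real n" by linarith
      have "real (N n) / real n - t = (real (N n) - real n * t) / real n"
        using n0 by (simp add: diff_divide_distrib)
      then have "norm (real (N n) / real n - t) = \<bar>real (N n) - real n * t\<bar> / real n"
        by simp
      also have "\<dots> \<le> (3 * (real n / real q) + real q) / real n" using bound n0 by (intro divide_right_mono) auto
      also have "\<dots> = 3 / real q + real q / real n" using n0 by (simp add: add_divide_distrib)
      also have "real q / real n < \<epsilon> / 2" using n n0 \<open>0 < \<epsilon>\<close> by (simp add: field_simps)
      finally show "norm (real (N n) / real n - t) < \<epsilon>" using q\<epsilon> by simp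
    qed
  qed
  then show "(\<lambda>n. real (card {i. i < n \<and> frac (\<rho> + real i * \<sigma>) < t}) / real n) \<longlonglongrightarrow> t"
    by (simp add: N_def)
qed

section \<open>Existence of examples and the characterization\<close>

lemma sturmian_perm_frac:
  assumes "\<sigma> \<notin> \<rat>" "0 < \<sigma>" "\<sigma> < 1"
  shows "equidistributed_perm (perm_of (\<lambda>n. frac (real n * \<sigma>)))" (is "equidistributed_perm ?\<alpha>")
    and "sturmian_perm (perm_of (\<lambda>n. frac (real n * \<sigma>)))"
proof -
  have "inj (\<lambda>n. frac (real n * \<sigma>))"
  proof (rule injI, rule ccontr)
    fix i j assume "frac (real i * \<sigma>) = frac (real j * \<sigma>)" "i \<noteq> j"
    then have "real i * \<sigma> - real j * \<sigma> = of_int (\<lfloor>real i * \<sigma>\<rfloor> - \<lfloor>real j * \<sigma>\<rfloor>)" by (simp add: frac_def)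
    then have "(real i - real j) * \<sigma> \<in> \<int>" by (metis Ints_of_int left_diff_distrib)
    then show False using irrational_mult_not_int[OF assms(1) \<open>i \<noteq> j\<close>] by blast
  qed
  then have rep: "is_representative (\<lambda>n. frac (real n * \<sigma>)) ?\<alpha>" by (simp add: is_representative_def)
  then show "equidistributed_perm ?\<alpha>"
    unfolding equidistributed_perm_def using equidistributed_rotation[OF assms(1), of 0] by auto
  show "sturmian_perm ?\<alpha>"
    unfolding sturmian_perm_def using rep assms by (intro exI[of _ \<sigma>] exI[of _ 0]) simp
qed

lemma equidistributed_complexity_ge:
  assumes "equidistributed_perm \<alpha>" "1 \<le> n"
  shows "n \<le> complexity \<alpha> n"
proof -
  obtain a where "inj a" "perm_of a = \<alpha>" "equidistributed_seq a"
    using assms(1) by (auto simp: equidistributed_perm_def is_representative_def)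
  then show ?thesis using chain_free.complexity_ge[OF chain_free_equidistributed] assms(2) by auto
qed

lemma minimal_complexity_iff_sturmian:
  assumes "equidistributed_perm \<alpha>"
  shows "(\<forall>n\<ge>1. complexity \<alpha> n = n) \<longleftrightarrow> sturmian_perm \<alpha>"
proof
  assume min: "\<forall>n\<ge>1. complexity \<alpha> n = n"
  obtain a where a: "inj a" "perm_of a = \<alpha>" "equidistributed_seq a"
    using assms by (auto simp: equidistributed_perm_def is_representative_def)
  interpret minimal_perm a
    using minimal_perm_complexity[OF chain_free_equidistributed] a min by auto
  show "sturmian_perm \<alpha>"
    using rotation_imp_sturmian[OF a(1) _ _ cyc_shift_imp_rotation[OF a(1,3) cyc_shift]]
      equidistributed_bounds[OF a(3)] a(2) by blast
next
  assume "sturmian_perm \<alpha>"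
  then show "\<forall>n\<ge>1. complexity \<alpha> n = n"
    using sturmian_complexity_le equidistributed_complexity_ge[OF assms] by (simp add: antisym)
qed

theorem theorem1:
  shows "(\<forall>\<alpha>. equidistributed_perm \<alpha> \<longrightarrow> (\<forall>n\<ge>1. complexity \<alpha> n \<ge> n))
     \<and> (\<exists>\<alpha>. equidistributed_perm \<alpha> \<and> (\<forall>n\<ge>1. complexity \<alpha> n = n))
     \<and> (\<forall>\<alpha>. equidistributed_perm \<alpha> \<longrightarrow>
           ((\<forall>n\<ge>1. complexity \<alpha> n = n) \<longleftrightarrow> sturmian_perm \<alpha>))"
proof -
  have "uncountable ({0<..<1::real} - \<rat>)"
    using uncountable_open_interval[of 0 "1::real"] countable_rat by (intro uncountable_minus_countable) auto
  then obtain \<sigma> :: real where "\<sigma> \<in> {0<..<1} - \<rat>" by (metis countable_empty equals0I)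
  then have "\<exists>\<alpha>. equidistributed_perm \<alpha> \<and> (\<forall>n\<ge>1. complexity \<alpha> n = n)"
    using sturmian_perm_frac[of \<sigma>] minimal_complexity_iff_sturmian by auto
  then show ?thesis
    using equidistributed_complexity_ge minimal_complexity_iff_sturmian by blast
qed

end
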